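(* Let $\xi_0,\xi_1,\xi_2,\dots$ be a $\psi$-mixing stationary process, let $\ell\ge 1$, and let $q_1,\dots,q_\ell$ be strictly increasing functions taking integer values on integers such that $$0\le q_1(n)<q_2(n)<\dots<q_\ell(n)\ \text{ for all } n\ge 0,\qquad q(n)=\min_{k\ge n}\ \min_{1\le i\le \ell-1}\bigl(q_{i+1}(k)-q_i(k)\bigr)\to\infty\ \text{ as } n\to\infty .$$ Then there is a constant $C>0$ such that for any disjoint Borel sets $\Gamma_0,\Gamma_1\subset\mathbb{R}$ with $Q(\Gamma_\alpha)>0$, $\alpha=0,1$, and any positive integers $M,R$ with $\psi(R)<2^{\frac1{\ell+1}}-1$, $$d_{TV}\bigl(\mathcal{L}(S_\tau),\mathrm{Geo}(\rho)\bigr)\le C\Bigl((1-Q(\Gamma_0)^\ell)^M+\bigl(Q(\Gamma_0)^\ell+Q(\Gamma_1)^\ell\bigr)\Bigl((Q(\Gamma_0)+Q(\Gamma_1))MR+M\psi(R)+\sum_{n=0}^M\psi(q(n))\Bigr)\Bigr)+2Q(\Gamma_1)^\ell,$$ where $$\rho=\frac{Q(\Gamma_0)^\ell}{Q(\Gamma_0)^\ell+Q(\Gamma_1)^\ell},$$ $X_{n,\alpha}=\prod_{i=1}^\ell\mathbb{I}_{\Gamma_\alpha}(\xi_{q_i(n)})$ for $\alpha=0,1$, $\tau=\min\{n\ge0: X_{n,0}=1\}$ and $S_\tau=\sum_{n=0}^{\tau-1}X_{n,1}$. The constant $C$ does not depend on $Q(\Gamma_0)$, $Q(\Gamma_1)$,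 $M$ and $R$.
   Context: The process $\xi_0,\xi_1,\dots$ is a stationary sequence of real random variables on a complete probability space $(\Omega,\mathcal{F},P)$. $Q$ denotes the distribution of $\xi_0$, i.e. $Q(\Gamma)=P\{\xi_0\in\Gamma\}$ for Borel $\Gamma\subset\mathbb{R}$. $\mathbb{I}_\Gamma$ is the indicator function of $\Gamma$. For $m\le n$ let $\mathcal{F}_{mn}=\sigma(\xi_m,\xi_{m+1},\dots,\xi_n)$ (and $\mathcal{F}_{m,\infty}=\sigma(\xi_m,\xi_{m+1},\dots)$). For $\sigma$-algebras $\mathcal{G},\mathcal{H}\subset\mathcal{F}$, $$\psi(\mathcal{G},\mathcal{H})=\sup_{\Gamma\in\mathcal{G},\,\Delta\in\mathcal{H}}\Bigl\{\Bigl|\frac{P(\Gamma\cap\Delta)}{P(\Gamma)P(\Delta)}-1\Bigr|:\ P(\Gamma)P(\Delta)\neq0\Bigr\},\qquad \psi(n)=\sup_{m\ge0}\psi(\mathcal{F}_{0,m},\mathcal{F}_{m+n,\infty}).$$ The process is called $\psi$-mixing if $\psi(1)<\infty$ and $\psi(n)\to0$ as $n\to\infty$. Conventions: $\tau=\infty$ if the set defining it is empty; $S_M=\sum_{n=0}^{M-1}X_{n,1}$ and $S_0=0$. If $\ell=1$, the minimum over the empty set defining $q(n)$ is $+\infty$ and $\psi(\infty)=0$. $\mathcal{L}(Y)$ is the distribution of $Y$, and $d_{TV}(\mathcal{L}(Y),\mathcal{L}(Z))=\sup_G|\mathcal{L}(Y)(G)-\mathcal{L}(Z)(G)|$ with the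 supremum over all Borel sets $G$. For $\rho\in(0,1)$, $\mathrm{Geo}(\rho)$ is the distribution on $\{0,1,2,\dots\}$ with $\mathrm{Geo}(\rho)\{k\}=\rho(1-\rho)^k$. *)

theory Defs
  imports "HOL-Probability.Probability"
begin

definition stationary_process :: "'w measure \<Rightarrow> (nat \<Rightarrow> 'w \<Rightarrow> real) \<Rightarrow> bool" where
  "stationary_process P \<xi> \<longleftrightarrow>
     (\<forall>n. \<xi> n \<in> borel_measurable P) \<and>
     (\<forall>k. distr P (\<Pi>\<^sub>M i\<in>UNIV. borel) (\<lambda>\<omega> n. \<xi> (n + k) \<omega>)
        = distr P (\<Pi>\<^sub>M i\<in>UNIV. borel) (\<lambda>\<omega> n. \<xi> n \<omega>))"

definition sigma_process :: "'w measure \<Rightarrow> (nat \<Rightarrow> 'w \<Rightarrow> real) \<Rightarrow> nat set \<Rightarrow> 'w set set" where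
  "sigma_process P \<xi> I = sigma_sets (space P) {\<xi> i -` A \<inter> space P | i A. i \<in> I \<and> A \<in> sets borel}"

text \<open>The dependence coefficients may be infinite, hence the extended real values.\<close>

definition psi_dep :: "'w measure \<Rightarrow> 'w set set \<Rightarrow> 'w set set \<Rightarrow> ereal" where
  "psi_dep P \<G> \<H> =
     (SUP (\<Gamma>, \<Delta>) \<in> {(\<Gamma>, \<Delta>). \<Gamma> \<in> \<G> \<and> \<Delta> \<in> \<H> \<and> measure P \<Gamma> * measure P \<Delta> \<noteq> 0}.
        ereal \<bar>measure P (\<Gamma> \<inter> \<Delta>) / (measure P \<Gamma> * measure P \<Delta>) - 1\<bar>)"

definition psi_coeff :: "'w measure \<Rightarrow> (nat \<Rightarrow> 'w \<Rightarrow> real) \<Rightarrow> enat \<Rightarrow> ereal" where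
  "psi_coeff P \<xi> N =
     (case N of
        enat n \<Rightarrow> (SUP m. psi_dep P (sigma_process P \<xi> {0..m}) (sigma_process P \<xi> {m + n..}))
      | \<infinity> \<Rightarrow> 0)"

definition psi_mixing :: "'w measure \<Rightarrow> (nat \<Rightarrow> 'w \<Rightarrow> real) \<Rightarrow> bool" where
  "psi_mixing P \<xi> \<longleftrightarrow>
     psi_coeff P \<xi> (enat 1) < \<infinity> \<and> (\<lambda>n. psi_coeff P \<xi> (enat n)) \<longlonglongrightarrow> 0"

text \<open>
  \<open>psi_coeff P \<xi> 0\<close> may be infinite even for a \<open>\<psi>\<close>-mixing process. All other coefficients are
  finite, so converting them to real numbers is harmless.
\<close>

lemma psi_coeff_finite:
  assumes "prob_space P" "psi_mixing P \<xi>" "n \<ge> 1"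
  shows "\<bar>psi_coeff P \<xi> (enat n)\<bar> \<noteq> \<infinity>"
proof -
  interpret prob_space P by fact
  have nonneg: "0 \<le> psi_dep P (sigma_process P \<xi> I) (sigma_process P \<xi> J)" for I J
  proof -
    have *: "space P \<in> sigma_process P \<xi> K" for K
      unfolding sigma_process_def by (rule sigma_sets_top)
    show ?thesis unfolding psi_dep_def
      by (rule SUP_upper2[of "(space P, space P)"]) (use * in \<open>auto simp: prob_space\<close>)
  qed
  have sub: "sigma_process P \<xi> I \<subseteq> sigma_process P \<xi> J" if "I \<subseteq> J" for I J
    unfolding sigma_process_def using that by (intro sigma_sets_mono') blast
  have "psi_coeff P \<xi> (enat n) \<le> psi_coeff P \<xi> (enat 1)"
    unfolding psi_coeff_def psi_dep_def enat.case
  proof (intro SUP_mono' SUP_subset_mono)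
    fix m
    have "sigma_process P \<xi> {m + n..} \<subseteq> sigma_process P \<xi> {m + 1..}"
      using assms(3) by (intro sub) auto
    then show "{(\<Gamma>, \<Delta>). \<Gamma> \<in> sigma_process P \<xi> {0..m} \<and> \<Delta> \<in> sigma_process P \<xi> {m + n..} \<and>
                measure P \<Gamma> * measure P \<Delta> \<noteq> 0}
       \<subseteq> {(\<Gamma>, \<Delta>). \<Gamma> \<in> sigma_process P \<xi> {0..m} \<and> \<Delta> \<in> sigma_process P \<xi> {m + 1..} \<and>
                measure P \<Gamma> * measure P \<Delta> \<noteq> 0}"
      by blast
  qed auto
  moreover have "0 \<le> psi_coeff P \<xi> (enat n)"
    unfolding psi_coeff_def enat.case by (rule SUP_upper2[of 0]) (auto intro: nonneg)
  ultimately show ?thesis using assms(2) unfolding psi_mixing_def by auto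
qed

text \<open>The infimum is taken in \<^typ>\<open>enat\<close>, so that it is \<open>\<infinity>\<close> for \<open>l = 1\<close>.\<close>

definition min_gap :: "nat \<Rightarrow> (nat \<Rightarrow> nat \<Rightarrow> nat) \<Rightarrow> nat \<Rightarrow> enat" where
  "min_gap l q n = (INF k\<in>{n..}. INF i\<in>{1..l - 1}. enat (q (i + 1) k - q i k))"

text \<open>\<open>hit \<xi> l q \<Gamma>\<^sub>\<alpha> n\<close> is the random variable \<open>X\<close> with indices \<open>n, \<alpha>\<close>.\<close>

definition hit ::
  "(nat \<Rightarrow> 'w \<Rightarrow> real) \<Rightarrow> nat \<Rightarrow> (nat \<Rightarrow> nat \<Rightarrow> nat) \<Rightarrow> real set \<Rightarrow> nat \<Rightarrow> 'w \<Rightarrow> real" where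
  "hit \<xi> l q \<Gamma> n \<omega> = (\<Prod>i=1..l. indicator \<Gamma> (\<xi> (q i n) \<omega>))"

definition hit_time ::
  "(nat \<Rightarrow> 'w \<Rightarrow> real) \<Rightarrow> nat \<Rightarrow> (nat \<Rightarrow> nat \<Rightarrow> nat) \<Rightarrow> real set \<Rightarrow> 'w \<Rightarrow> enat" where
  "hit_time \<xi> l q \<Gamma> \<omega> = Inf {enat n | n. hit \<xi> l q \<Gamma> n \<omega> = 1}"

text \<open>
  \<open>hit_count \<xi> l q \<Gamma> T \<omega>\<close> sums over all \<open>n < T\<close>. It takes values in \<^typ>\<open>ereal\<close>, because
  the sum may be infinite on the event that \<open>T\<close> is infinite.
\<close>

definition hit_count ::
  "(nat \<Rightarrow> 'w \<Rightarrow> real) \<Rightarrow> nat \<Rightarrow> (nat \<Rightarrow> nat \<Rightarrow> nat) \<Rightarrow> real set \<Rightarrow> enat \<Rightarrow> 'w \<Rightarrow> ereal" where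
  "hit_count \<xi> l q \<Gamma> T \<omega> = (\<Sum>n. if enat n < T then ereal (hit \<xi> l q \<Gamma> n \<omega>) else 0)"

definition stopped_count ::
  "(nat \<Rightarrow> 'w \<Rightarrow> real) \<Rightarrow> nat \<Rightarrow> (nat \<Rightarrow> nat \<Rightarrow> nat) \<Rightarrow> real set \<Rightarrow> real set \<Rightarrow> 'w \<Rightarrow> ereal" where
  "stopped_count \<xi> l q \<Gamma>0 \<Gamma>1 \<omega> = hit_count \<xi> l q \<Gamma>1 (hit_time \<xi> l q \<Gamma>0 \<omega>) \<omega>"

definition tv_dist :: "'b measure \<Rightarrow> 'b measure \<Rightarrow> real" where
  "tv_dist \<mu> \<nu> = (SUP G\<in>sets \<mu>. \<bar>measure \<mu> G - measure \<nu> G\<bar>)"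

definition Geo :: "real \<Rightarrow> ereal measure" where
  "Geo \<rho> = distr (measure_pmf (geometric_pmf \<rho>)) borel (\<lambda>k. ereal (real k))"

end

theory Submission
  imports Defs
begin

text \<open>
  Write \<open>p\<^sub>\<alpha> = Q(\<Gamma>\<^sub>\<alpha>)\<^sup>l\<close>, and let \<open>v s\<close> be the probability that \<open>s + Y \<in> G\<close> for a variable \<open>Y\<close>
  with law \<open>Geo(\<rho>)\<close>. Unfolding one trial gives \<open>v s = \<rho> 1\<^sub>G(s) + (1 - \<rho>) v (s + 1)\<close>, that is,
  \<open>p\<^sub>0 (1\<^sub>G(s) - v s) + p\<^sub>1 (v (s + 1) - v s) = 0\<close>. Let \<open>S\<^sub>n\<close> count the hits of \<open>\<Gamma>\<^sub>1\<close> before time \<open>n\<close>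
  and put \<open>V\<^sub>n = v (S\<^sub>n)\<close> as long as \<open>\<Gamma>\<^sub>0\<close> has not been hit before \<open>n\<close>, and \<open>V\<^sub>n = 1\<^sub>G(S\<^sub>\<tau>)\<close> afterwards.
  Then \<open>V\<^sub>0 = Geo(\<rho>)(G)\<close>, and \<open>V\<^sub>M\<close> is the indicator of \<open>S\<^sub>\<tau> \<in> G\<close> unless \<open>\<tau> \<ge> M\<close>. Were the hits
  at time \<open>n\<close> independent of the past with probabilities \<open>p\<^sub>0\<close> and \<open>p\<^sub>1\<close>, the process \<open>V\<close> would be a
  martingale. In general the one-step equation turns \<open>V\<^sub>n\<^sub>+\<^sub>1 - V\<^sub>n\<close> into a sum over \<open>\<alpha>\<close> of terms
  \<open>(X\<^sub>n\<^sub>,\<^sub>\<alpha> - p\<^sub>\<alpha>) h\<^sub>\<alpha>\<close>, where \<open>h\<^sub>\<alpha>\<close> is bounded by 1 and depends only on the hits before \<open>n\<close>. So it is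
  enough to bound the expectation of such a term, and the same bound controls \<open>P(\<tau> \<ge> M)\<close> by
  \<open>(1 - p\<^sub>0)\<^sup>M\<close> plus the accumulated errors.

  For one term, the times \<open>m < n\<close> are split into those that are near, where some \<open>q\<^sub>j(m)\<close> is closer
  than \<open>R\<close> to some \<open>q\<^sub>i(n)\<close>, and the others. There are at most \<open>2 R l\<^sup>2\<close> near times. Deleting their
  hits from \<open>h\<^sub>\<alpha>\<close> matters only if one of them is a hit, which together with a hit at \<open>n\<close> requires
  \<open>l + 1\<close> different indices; this gives the contribution of order
  \<open>R Q(\<Gamma>\<^sub>\<alpha>) (Q(\<Gamma>\<^sub>0)\<^sup>l + Q(\<Gamma>\<^sub>1)\<^sup>l)\<close> (\<open>past_decoupling\<close>).

  What remains depends on values \<open>\<xi>\<^sub>s\<close> at indices at distance at least \<open>R\<close> from all \<open>q\<^sub>i(n)\<close>. These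
  indices lie before and between the \<open>q\<^sub>i(n)\<close>, so past and future cannot be separated by
  a single cut. But \<open>\<psi>\<close>-mixing bounds the \<^emph>\<open>relative\<close> error when an intersection of
  cylinder events over time blocks is replaced by the product of the probabilities
  (\<open>block_factorization\<close>). Relative errors multiply along successive blocks, and they remain
  summable over all cylinder events that the past can take (\<open>far_past_decoupling\<close>). Both the cylinder and its
  intersection with a hit at \<open>n\<close> are compared with the same product (\<open>cell_estimate\<close>); the smallness
  assumption on \<open>\<psi>(R)\<close> is used to return from this product to the probability of the cylinder.
\<close>

section \<open>Elementary estimates\<close>

text \<open>
  Relative errors compose multiplicatively: replacing \<open>x\<close> by \<open>y z\<close> at the relative cost \<open>\<psi>\<close>, and then
  \<open>y\<close> by \<open>w\<close> at the relative cost \<open>c - 1\<close>, multiplies the factors \<open>1 + \<psi>\<close> and \<open>c\<close>.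
\<close>

lemma relative_error_step:
  fixes x y z w c \<psi> :: real
  assumes "\<bar>x - y * z\<bar> \<le> \<psi> * (y * z)" "\<bar>y - w\<bar> \<le> (c - 1) * w" "0 \<le> z" "0 \<le> \<psi>"
  shows "\<bar>x - w * z\<bar> \<le> (c * (1 + \<psi>) - 1) * (w * z)"
proof -
  have "\<bar>y * z - w * z\<bar> = \<bar>y - w\<bar> * z"
    using assms(3) by (simp add: left_diff_distrib[symmetric] abs_mult)
  also have "\<dots> \<le> ((c - 1) * w) * z"
    by (rule mult_right_mono) (use assms in auto)
  finally have 1: "\<bar>y * z - w * z\<bar> \<le> (c - 1) * w * z" .
  have "y * z \<le> c * w * z"
    using assms(2,3) by (intro mult_right_mono) (auto simp: algebra_simps)
  then have "\<psi> * (y * z) \<le> \<psi> * (c * w * z)"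
    using assms(4) by (rule mult_left_mono)
  then have "\<bar>x - w * z\<bar> \<le> \<psi> * (c * w * z) + (c - 1) * w * z"
    using 1 assms(1) by linarith
  then show ?thesis by (simp add: algebra_simps)
qed

lemma power_minus_1_le:
  fixes x :: real
  assumes "0 \<le> x"
  shows "(1 + x) ^ k - 1 \<le> real k * x * (1 + x) ^ k"
proof (induction k)
  case (Suc k)
  have "1 \<le> (1 + x) ^ k" using assms by (simp add: one_le_power)
  have "(1 + x) ^ Suc k - 1 = (1 + x) * ((1 + x) ^ k - 1) + x" by (simp add: algebra_simps)
  also have "\<dots> \<le> (1 + x) * (real k * x * (1 + x) ^ k) + x * (1 + x) ^ Suc k"
  proof (rule add_mono)
    have "1 \<le> (1 + x) ^ Suc k" using assms by (intro one_le_power) simp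
    then show "x \<le> x * (1 + x) ^ Suc k"
      using mult_left_mono[of 1 "(1 + x) ^ Suc k" x] assms by simp
  qed (intro mult_left_mono Suc; use assms in simp)
  finally show ?case by (simp add: algebra_simps)
qed simp

lemma prod_even_odd:
  fixes f :: "nat \<Rightarrow> 'c :: comm_monoid_mult"
  shows "(\<Prod>k<2 * K. f k) = (\<Prod>j<K. f (2 * j)) * (\<Prod>j<K. f (2 * j + 1))"
  by (induction K) (auto simp: ac_simps)

section \<open>The geometric law as a solution of a one-step equation\<close>

lemma measure_bernoulli_bind:
  fixes f :: "bool \<Rightarrow> nat pmf"
  assumes "0 \<le> p" "p \<le> 1"
  shows "measure_pmf.prob (bernoulli_pmf p \<bind> f) X
     = p * measure_pmf.prob (f True) X + (1 - p) * measure_pmf.prob (f False) X"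
proof -
  have "ennreal (measure_pmf.prob (bernoulli_pmf p \<bind> f) X)
      = (\<integral>\<^sup>+b. ennreal (measure_pmf.prob (f b) X) \<partial>bernoulli_pmf p)"
    by (simp add: measure_pmf.emeasure_eq_measure[symmetric])
  also have "\<dots> = ennreal (p * measure_pmf.prob (f True) X + (1 - p) * measure_pmf.prob (f False) X)"
    using assms by (simp add: ennreal_mult'[symmetric] ennreal_plus[symmetric] mult.commute del: ennreal_plus)
  finally show ?thesis
    by (subst (asm) ennreal_inj) (use assms in auto)
qed

text \<open>
  The first trial either stops the count at \<open>s\<close> or raises it by one, after which the remaining
  number of successes is again geometric.
\<close>

lemma geometric_tail_recurrence:
  fixes \<rho> :: real and G :: "ereal set"
  assumes "0 < \<rho>" "\<rho> \<le> 1"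
  defines "v \<equiv> \<lambda>s. measure_pmf.prob (geometric_pmf \<rho>) {k. ereal (real (s + k)) \<in> G}"
  shows "v s = \<rho> * of_bool (ereal (real s) \<in> G) + (1 - \<rho>) * v (Suc s)"
proof -
  have "v s = measure_pmf.prob (bernoulli_pmf \<rho> \<bind>
      (\<lambda>b. if b then return_pmf 0 else map_pmf Suc (geometric_pmf \<rho>))) {k. ereal (real (s + k)) \<in> G}"
    unfolding v_def using assms by (subst geometric_bind_pmf_unfold) auto
  also have "\<dots> = \<rho> * of_bool (ereal (real s) \<in> G) + (1 - \<rho>) * v (Suc s)"
    using assms by (subst measure_bernoulli_bind)
      (auto simp: v_def indicator_def of_bool_def measure_return_pmf add_ac)
  finally show ?thesis .
qed

text \<open>
  The martingale of the ideal model. The sets \<open>a\<close> and \<open>b\<close> are the times at which the hazard set and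
  the counted set are hit: as long as there is no hazard before \<open>n\<close> the value is \<open>v\<close> at the current
  count, and from then on it is frozen at \<open>\<phi>\<close> of the count at the first hazard.
\<close>

definition hazard_value :: "(nat \<Rightarrow> real) \<Rightarrow> (nat \<Rightarrow> real) \<Rightarrow> nat \<Rightarrow> nat set \<Rightarrow> nat set \<Rightarrow> real" where
  "hazard_value v \<phi> n a b = (if a \<inter> {..<n} = {} then v (card (b \<inter> {..<n}))
      else \<phi> (card (b \<inter> {..<(LEAST m. m \<in> a)})))"

lemma hazard_value_Suc:
  assumes "a \<inter> b = {}"
  shows "hazard_value v \<phi> (Suc n) a b - hazard_value v \<phi> n a b
    = of_bool (a \<inter> {..<n} = {}) * (of_bool (n \<in> a) * (\<phi> (card (b \<inter> {..<n})) - v (card (b \<inter> {..<n})))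
        + of_bool (n \<in> b) * (v (Suc (card (b \<inter> {..<n}))) - v (card (b \<inter> {..<n}))))"
proof (cases "a \<inter> {..<n} = {}")
  case False
  then have "a \<inter> {..<Suc n} \<noteq> {}" by auto
  with False show ?thesis by (simp add: hazard_value_def)
next
  case True
  show ?thesis
  proof (cases "n \<in> a")
    case na: True
    have "(LEAST m. m \<in> a) = n"
      by (rule Least_equality, rule na) (use True in force)
    moreover have "a \<inter> {..<Suc n} \<noteq> {}" "n \<notin> b" using na assms by auto
    ultimately show ?thesis using True na by (simp add: hazard_value_def)
  next
    case False
    then have "a \<inter> {..<Suc n} = {}" using True by (auto simp: lessThan_Suc)
    moreover have "card (b \<inter> {..<Suc n}) = card (b \<inter> {..<n}) + of_bool (n \<in> b)"
      by (simp add: lessThan_Suc Int_insert_right)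
    ultimately show ?thesis using True False by (simp add: hazard_value_def)
  qed
qed

section \<open>Factorization over time blocks\<close>

locale psi_mixing_process = prob_space P for P :: "'w measure" +
  fixes \<xi> :: "nat \<Rightarrow> 'w \<Rightarrow> real"
  assumes stationary: "stationary_process P \<xi>"
    and mixing: "psi_mixing P \<xi>"
begin

definition psi :: "enat \<Rightarrow> real" where
  "psi N = real_of_ereal (psi_coeff P \<xi> N)"

definition law :: "real set \<Rightarrow> real" where
  "law A = measure (distr P borel (\<xi> 0)) A"

definition cyl :: "nat set \<Rightarrow> (nat \<Rightarrow> real set) \<Rightarrow> 'w set" where
  "cyl T A = {\<omega> \<in> space P. \<forall>s\<in>T. \<xi> s \<omega> \<in> A s}"

lemma measurable_xi [measurable]: "\<xi> n \<in> borel_measurable P"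
  using stationary by (auto simp: stationary_process_def)

lemma marginal:
  assumes A: "A \<in> sets borel"
  shows "prob {\<omega> \<in> space P. \<xi> s \<omega> \<in> A} = law A"
proof -
  have m: "(\<lambda>\<omega> n. \<xi> (n + k) \<omega>) \<in> measurable P (\<Pi>\<^sub>M i\<in>UNIV. borel)" for k
    by (rule measurable_PiM_single') auto
  have "distr P borel (\<xi> k) = distr (distr P (\<Pi>\<^sub>M i\<in>UNIV. borel) (\<lambda>\<omega> n. \<xi> (n + k) \<omega>)) borel (\<lambda>f. f 0)" for k
    by (subst distr_distr) (use m in \<open>auto simp: comp_def\<close>)
  moreover have "distr P (\<Pi>\<^sub>M i\<in>UNIV. borel) (\<lambda>\<omega> n. \<xi> (n + k) \<omega>)
      = distr P (\<Pi>\<^sub>M i\<in>UNIV. borel) (\<lambda>\<omega> n. \<xi> n \<omega>)" for k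
    using stationary unfolding stationary_process_def by blast
  ultimately have "distr P borel (\<xi> s) = distr P borel (\<xi> 0)"
    by metis
  then have "law A = measure (distr P borel (\<xi> s)) A"
    by (simp add: law_def)
  also have "\<dots> = prob {\<omega> \<in> space P. \<xi> s \<omega> \<in> A}"
    by (subst measure_distr) (use A in \<open>auto intro!: arg_cong[where f=prob]\<close>)
  finally show ?thesis by simp
qed

lemma law_nonneg: "0 \<le> law A"
  by (simp add: law_def)

lemma law_le_1: "law A \<le> 1"
proof -
  interpret D: prob_space "distr P borel (\<xi> 0)"
    by (rule prob_space_distr) simp
  show ?thesis unfolding law_def by (rule D.prob_le_1)
qed

lemma psi_coeff_mono:
  assumes "a \<le> b"
  shows "psi_coeff P \<xi> (enat b) \<le> psi_coeff P \<xi> (enat a)"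
proof -
  have "psi_dep P (sigma_process P \<xi> {0..m}) (sigma_process P \<xi> {m + b..})
      \<le> psi_dep P (sigma_process P \<xi> {0..m}) (sigma_process P \<xi> {m + a..})" for m
  proof -
    have "sigma_process P \<xi> {m + b..} \<subseteq> sigma_process P \<xi> {m + a..}"
      unfolding sigma_process_def using assms by (intro sigma_sets_mono') force
    then show ?thesis
      unfolding psi_dep_def by (intro SUP_subset_mono) auto
  qed
  then show ?thesis unfolding psi_coeff_def by (auto intro!: SUP_mono')
qed


lemma psi_coeff_nonneg: "0 \<le> psi_coeff P \<xi> N"
proof (cases N)
  case (enat n)
  have *: "space P \<in> sigma_process P \<xi> K" for K
    unfolding sigma_process_def by (rule sigma_sets_top)
  have "0 \<le> psi_dep P (sigma_process P \<xi> I) (sigma_process P \<xi> J)" for I J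
    unfolding psi_dep_def
    by (rule SUP_upper2[of "(space P, space P)"]) (use * in \<open>auto simp: prob_space\<close>)
  then show ?thesis
    unfolding psi_coeff_def enat enat.case by (intro SUP_upper2[of 0]) auto
qed (simp add: psi_coeff_def)

lemma psi_nonneg: "0 \<le> psi N"
  unfolding psi_def by (intro real_of_ereal_pos psi_coeff_nonneg)

lemma psi_mono:
  assumes "1 \<le> a" "a \<le> b"
  shows "psi (enat b) \<le> psi (enat a)"
  unfolding psi_def
  using psi_coeff_mono[OF assms(2)] psi_coeff_finite[OF prob_space_axioms mixing, of a] assms
    psi_coeff_nonneg[of "enat b"]
  by (intro real_of_ereal_positive_mono) auto

lemma sigma_process_events: "sigma_process P \<xi> I \<subseteq> events"
  unfolding sigma_process_def by (rule sets.sigma_sets_subset) auto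

text \<open>
  If one of the events is null, so is the intersection; hence the bound by \<open>\<psi>\<close> carries over to
  all events once the denominators in its definition are cleared.
\<close>

lemma two_block_bound:
  assumes E: "E \<in> sigma_process P \<xi> {0..m}" and F: "F \<in> sigma_process P \<xi> {m + g..}"
    and g: "1 \<le> g"
  shows "\<bar>prob (E \<inter> F) - prob E * prob F\<bar> \<le> psi (enat g) * (prob E * prob F)"
proof (cases "prob E * prob F = 0")
  case True
  have "E \<in> events" "F \<in> events" using E F sigma_process_events by auto
  then have "prob (E \<inter> F) \<le> prob E" "prob (E \<inter> F) \<le> prob F"
    by (auto intro!: finite_measure_mono)
  then have "prob (E \<inter> F) = 0"
    using True measure_nonneg[of P "E \<inter> F"] by (auto intro: order_antisym)
  then show ?thesis unfolding True by simp
next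
  case False
  have "ereal \<bar>prob (E \<inter> F) / (prob E * prob F) - 1\<bar>
      \<le> psi_dep P (sigma_process P \<xi> {0..m}) (sigma_process P \<xi> {m + g..})"
    unfolding psi_dep_def by (rule SUP_upper2[of "(E, F)"]) (use E F False in auto)
  also have "\<dots> \<le> psi_coeff P \<xi> (enat g)"
    unfolding psi_coeff_def enat.case by (rule SUP_upper) simp
  also have "\<dots> = ereal (psi (enat g))"
    unfolding psi_def using psi_coeff_finite[OF prob_space_axioms mixing g] by (simp add: ereal_real')
  finally have *: "\<bar>prob (E \<inter> F) / (prob E * prob F) - 1\<bar> \<le> psi (enat g)" by simp
  have pos: "prob E * prob F > 0" using False by (simp add: order_less_le)
  have "prob (E \<inter> F) - prob E * prob F = (prob (E \<inter> F) / (prob E * prob F) - 1) * (prob E * prob F)"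
    using False by (simp add: field_simps)
  then have "\<bar>prob (E \<inter> F) - prob E * prob F\<bar>
      = \<bar>prob (E \<inter> F) / (prob E * prob F) - 1\<bar> * (prob E * prob F)"
    using pos by (simp add: abs_mult)
  also have "\<dots> \<le> psi (enat g) * (prob E * prob F)"
    by (rule mult_right_mono[OF *]) (use pos in simp)
  finally show ?thesis .
qed

lemma cyl_in_sigma_process:
  assumes "finite T" "T \<subseteq> I" "\<And>s. s \<in> T \<Longrightarrow> A s \<in> sets borel"
  shows "cyl T A \<in> sigma_process P \<xi> I"
proof -
  have sub: "{\<xi> i -` A \<inter> space P | i A. i \<in> I \<and> A \<in> sets borel} \<subseteq> Pow (space P)" by auto
  interpret sigma_algebra "space P" "sigma_process P \<xi> I"
    unfolding sigma_process_def by (rule sigma_algebra_sigma_sets[OF sub])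
  show ?thesis using assms
  proof (induction T rule: finite_induct)
    case empty
    have "cyl {} A = space P" by (auto simp: cyl_def)
    then show ?case by simp
  next
    case (insert s T)
    have "cyl (insert s T) A = (\<xi> s -` A s \<inter> space P) \<inter> cyl T A"
      by (auto simp: cyl_def)
    moreover have "\<xi> s -` A s \<inter> space P \<in> sigma_process P \<xi> I"
      unfolding sigma_process_def by (rule sigma_sets.Basic) (use insert in blast)
    ultimately show ?case using insert by auto
  qed
qed

lemma cyl_cong: "(\<And>s. s \<in> T \<Longrightarrow> A s = B s) \<Longrightarrow> cyl T A = cyl T B"
  by (auto simp: cyl_def)

lemma cyl_Un: "cyl (S \<union> T) A = cyl S A \<inter> cyl T A"
  by (auto simp: cyl_def)

lemma cyl_empty: "cyl {} A = space P"
  by (simp add: cyl_def)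

lemma prob_cyl_singleton: "A s \<in> sets borel \<Longrightarrow> prob (cyl {s} A) = law (A s)"
  using marginal[of "A s" s] by (simp add: cyl_def)

text \<open>
  The blocks are split off one at a time, from the last one to the first; by \<open>two_block_bound\<close> each
  step costs a factor \<open>1 + \<psi>(g)\<close>. That the error is relative to the product is essential: it is
  what allows sums over arbitrarily many cylinder events, and it gives errors proportional to
  \<open>law A ^ l\<close> for hits.
\<close>

lemma block_factorization:
  assumes g: "1 \<le> g"
    and fin: "\<And>k. k < K \<Longrightarrow> finite (S k)"
    and gap: "\<And>j k s t. j < k \<Longrightarrow> k < K \<Longrightarrow> s \<in> S j \<Longrightarrow> t \<in> S k \<Longrightarrow> s + g \<le> t"
    and A: "\<And>s. A s \<in> sets borel"
  shows "\<bar>prob (cyl (\<Union>k<K. S k) A) - (\<Prod>k<K. prob (cyl (S k) A))\<bar>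
      \<le> ((1 + psi (enat g)) ^ K - 1) * (\<Prod>k<K. prob (cyl (S k) A))"
  using fin gap
proof (induction K)
  case 0
  then show ?case by (simp add: cyl_empty prob_space)
next
  case (Suc K)
  define U where "U = (\<Union>k<K. S k)"
  have IH: "\<bar>prob (cyl U A) - (\<Prod>k<K. prob (cyl (S k) A))\<bar>
      \<le> ((1 + psi (enat g)) ^ K - 1) * (\<Prod>k<K. prob (cyl (S k) A))"
    unfolding U_def by (rule Suc.IH) (use Suc.prems in \<open>auto simp: less_Suc_eq\<close>)
  have finU: "finite U" unfolding U_def using Suc.prems by auto
  have gapU: "s + g \<le> t" if "s \<in> U" "t \<in> S K" for s t
    using that Suc.prems(2)[of _ K s t] unfolding U_def by auto
  have "\<bar>prob (cyl U A \<inter> cyl (S K) A) - prob (cyl U A) * prob (cyl (S K) A)\<bar>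
      \<le> psi (enat g) * (prob (cyl U A) * prob (cyl (S K) A))"
  \<comment> \<open>Blocks may be empty, so there may be no largest index \<open>Max U\<close> at which to cut.\<close>
  proof (cases "U = {}")
    case True
    have "cyl (S K) A \<subseteq> space P" by (auto simp: cyl_def)
    then show ?thesis using True by (simp add: cyl_empty prob_space psi_nonneg Int_absorb1)
  next
    case False
    show ?thesis
    proof (rule two_block_bound[where m = "Max U"])
      show "cyl U A \<in> sigma_process P \<xi> {0..Max U}"
        by (rule cyl_in_sigma_process) (use finU A in auto)
      show "cyl (S K) A \<in> sigma_process P \<xi> {Max U + g..}"
        by (rule cyl_in_sigma_process)
          (use Suc.prems(1) A gapU[OF Max_in[OF finU False]] in auto)
    qed (rule g)
  qed
  then have "\<bar>prob (cyl U A \<inter> cyl (S K) A) - (\<Prod>k<K. prob (cyl (S k) A)) * prob (cyl (S K) A)\<bar>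
      \<le> ((1 + psi (enat g)) ^ K * (1 + psi (enat g)) - 1)
        * ((\<Prod>k<K. prob (cyl (S k) A)) * prob (cyl (S K) A))"
    by (rule relative_error_step[OF _ IH]) (auto intro: psi_nonneg)
  moreover have "(\<Union>k<Suc K. S k) = U \<union> S K"
    by (auto simp: U_def less_Suc_eq)
  ultimately show ?case by (simp add: cyl_Un mult.commute)
qed

lemma sets_cyl:
  assumes "finite T" "\<And>s. A s \<in> sets borel"
  shows "cyl T A \<in> events"
  using cyl_in_sigma_process[OF assms(1) subset_refl, of A] assms(2) sigma_process_events by blast

end

section \<open>Decoupling a multiple hit from the past\<close>

locale hitting_times = psi_mixing_process P \<xi> for P :: "'w measure" and \<xi> +
  fixes l :: nat and q :: "nat \<Rightarrow> nat \<Rightarrow> nat"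
  assumes l_pos: "1 \<le> l"
    and q_mono: "\<forall>i\<in>{1..l}. strict_mono (q i)"
    and q_less: "\<forall>n. \<forall>i\<in>{1..<l}. q i n < q (i + 1) n"
begin

definition hits :: "real set \<Rightarrow> 'w \<Rightarrow> nat set" where
  "hits A \<omega> = {n. \<forall>i\<in>{1..l}. \<xi> (q i n) \<omega> \<in> A}"

text \<open>
  The times \<open>m\<close> before \<open>n\<close> whose hits are not separated by gaps of length \<open>R\<close> from a hit at \<open>n\<close>.
\<close>

definition near :: "nat \<Rightarrow> nat \<Rightarrow> nat set" where
  "near R n = {m. m < n \<and> (\<exists>i\<in>{1..l}. \<exists>j\<in>{1..l}. q j m < q i n + R \<and> q i n < q j m + R)}"

text \<open>
  The denominator is positive and stems from \<open>(1 + \<psi>(R))\<^sup>l < 2\<^sup>l\<^sup>/\<^sup>(\<^sup>l\<^sup>+\<^sup>1\<^sup>) < 2\<close>: it bounds from below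
  the ratio of the probability of a cylinder event to the product over its \<open>l\<close> blocks.
\<close>

definition decoupling_const :: real where
  "decoupling_const = 4 * real l * (1 + psi 1) ^ (2 * l) / (2 - 2 powr (real l / (real l + 1)))"

text \<open>
  For each pair of \<open>i\<close> and \<open>j\<close>, the injective function \<open>q\<^sub>j\<close> maps the times in question into an interval of
  at most \<open>2 R\<close> integers around \<open>q\<^sub>i(n)\<close>.
\<close>

lemma card_near: "card (near R n) \<le> l * (l * (2 * R))"
proof -
  have each: "finite {m. q j m < a + R \<and> a < q j m + R} \<and> card {m. q j m < a + R \<and> a < q j m + R} \<le> 2 * R"
    if "j \<in> {1..l}" for a j
  proof -
    have inj: "inj_on (q j) X" for X
      using q_mono that strict_mono_imp_inj_on inj_on_subset by blast
    have sub: "q j ` {m. q j m < a + R \<and> a < q j m + R} \<subseteq> {a - R..<a + R}"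
      by auto
    have "card {m. q j m < a + R \<and> a < q j m + R} \<le> card {a - R..<a + R}"
      by (rule card_inj_on_le[OF inj sub]) simp
    moreover have "finite {m. q j m < a + R \<and> a < q j m + R}"
      by (rule inj_on_finite[OF inj sub]) simp
    ultimately show ?thesis by auto
  qed
  let ?U = "\<Union>i\<in>{1..l}. \<Union>j\<in>{1..l}. {m. q j m < q i n + R \<and> q i n < q j m + R}"
  have "card (near R n) \<le> card ?U"
    by (rule card_mono) (use each in \<open>auto simp: near_def\<close>)
  also have "\<dots> \<le> (\<Sum>i\<in>{1..l}. card (\<Union>j\<in>{1..l}. {m. q j m < q i n + R \<and> q i n < q j m + R}))"
    by (rule card_UN_le) simp
  also have "\<dots> \<le> (\<Sum>i\<in>{1..l}. \<Sum>j\<in>{1..l}. card {m. q j m < q i n + R \<and> q i n < q j m + R})"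
    by (intro sum_mono card_UN_le) simp
  also have "\<dots> \<le> (\<Sum>i\<in>{1..l}. \<Sum>j\<in>{1..l}. 2 * R)"
    using each by (intro sum_mono) auto
  also have "\<dots> = l * (l * (2 * R))" by simp
  finally show ?thesis .
qed

lemma q_index_mono: "1 \<le> i \<Longrightarrow> i < j \<Longrightarrow> j \<le> l \<Longrightarrow> q i n < q j n"
proof (induction j)
  case (Suc j)
  have "q j n < q (Suc j) n" if "1 \<le> j" using q_less Suc.prems that by auto
  with Suc show ?case by (cases "i = j") (force simp: less_Suc_eq)+
qed simp

lemma q_index_mono_le: "1 \<le> i \<Longrightarrow> i \<le> j \<Longrightarrow> j \<le> l \<Longrightarrow> q i n \<le> q j n"
  using q_index_mono[of i j n] by (cases "i = j") auto

lemma q_past_less: "m < n \<Longrightarrow> i \<in> {1..l} \<Longrightarrow> q i m < q l n"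
  using q_index_mono_le[of i l n] q_mono strict_monoD[of "q i" m n] by fastforce

lemma min_gap_le: "i \<in> {1..<l} \<Longrightarrow> min_gap l q n \<le> enat (q (i + 1) n - q i n)"
  unfolding min_gap_def by (rule INF_lower2[of n], simp, rule INF_lower) auto

lemma min_gap_ge_1: "1 \<le> min_gap l q n"
  unfolding min_gap_def one_enat_def
  using q_less by (intro INF_greatest) (auto simp: Suc_le_eq)

lemma psi_le_psi_1: "1 \<le> N \<Longrightarrow> psi N \<le> psi 1"
proof (cases N)
  case (enat n)
  assume "1 \<le> N"
  with enat show ?thesis using psi_mono[of 1 n] by (simp add: one_enat_def)
next
  case infinity
  then show ?thesis using psi_nonneg[of 1] by (simp add: psi_def psi_coeff_def)
qed

text \<open>
  The indices of a hit at \<open>n\<close> may be closer to each other than \<open>R\<close>. The smaller of \<open>R\<close> and the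
  minimal gap serves for all blocks at once, and its coefficient is one of the two on the right.
  If \<open>l = 1\<close> the minimal gap is infinite and the choice is \<open>R\<close>.
\<close>

lemma common_gap:
  assumes R: "1 \<le> R"
  obtains g where "1 \<le> g" "g \<le> R" "\<And>i. i \<in> {1..<l} \<Longrightarrow> q i n + g \<le> q (i + 1) n"
    "psi (enat g) \<le> psi (enat R) + psi (min_gap l q n)"
proof (cases "enat R \<le> min_gap l q n")
  case True
  show thesis
  proof (rule that[of R])
    fix i assume i: "i \<in> {1..<l}"
    have "enat R \<le> enat (q (i + 1) n - q i n)"
      using True min_gap_le[OF i, of n] by (rule order_trans)
    moreover have "q i n < q (i + 1) n" using q_less i by auto
    ultimately show "q i n + R \<le> q (i + 1) n" by simp
  qed (use R psi_nonneg in auto)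
next
  case False
  then obtain g where g: "min_gap l q n = enat g"
    by (cases "min_gap l q n") auto
  show thesis
  proof (rule that[of g])
    show "1 \<le> g" using min_gap_ge_1[of n] g by (simp add: one_enat_def)
    fix i assume i: "i \<in> {1..<l}"
    have "enat g \<le> enat (q (i + 1) n - q i n)"
      using min_gap_le[OF i, of n] g by simp
    moreover have "q i n < q (i + 1) n" using q_less i by auto
    ultimately show "q i n + g \<le> q (i + 1) n" by simp
  qed (use False g psi_nonneg in auto)
qed

text \<open>
  The indices \<open>t\<^sub>0 < \<dots> < t\<^sub>l\<^sub>-\<^sub>1\<close> of a hit at \<open>n\<close> cut \<open>T\<close> into \<open>l\<close> blocks, none of them beyond the last
  index. With \<open>w\<close> the product of the block probabilities, the cylinder over \<open>T\<close> has probability close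
  to \<open>w\<close>, with gaps \<open>R\<close>, and its intersection with the hit has probability close to \<open>w * law A ^ l\<close>, from the
  \<open>2 l\<close> blocks that alternate between pieces of \<open>T\<close> and single indices \<open>t\<^sub>j\<close>. Eliminating \<open>w\<close> gives
  the claim.
\<close>

lemma cell_estimate:
  assumes R: "1 \<le> R" and psiR: "psi (enat R) < 2 powr (1 / (real l + 1)) - 1"
    and A: "A \<in> sets borel" and D: "\<And>s. D s \<in> sets borel"
    and T: "finite T" "\<And>s. s \<in> T \<Longrightarrow> s < q l n"
    and far: "\<And>s i. s \<in> T \<Longrightarrow> i \<in> {1..l} \<Longrightarrow> s + R \<le> q i n \<or> q i n + R \<le> s"
  shows "\<bar>prob ({\<omega> \<in> space P. n \<in> hits A \<omega>} \<inter> cyl T D) - law A ^ l * prob (cyl T D)\<bar>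
     \<le> decoupling_const * (psi (enat R) + psi (min_gap l q n)) * law A ^ l * prob (cyl T D)"
proof -
  obtain g where g: "1 \<le> g" "g \<le> R" and gap: "\<And>i. i \<in> {1..<l} \<Longrightarrow> q i n + g \<le> q (i + 1) n"
    and psig: "psi (enat g) \<le> psi (enat R) + psi (min_gap l q n)"
    using common_gap[OF R] by metis
  define t where "t j = q (Suc j) n" for j
  have t_mono: "t i < t j" if "i < j" "j < l" for i j
    unfolding t_def using that by (intro q_index_mono) auto
  have t_mono_le: "t i \<le> t j" if "i \<le> j" "j < l" for i j
    unfolding t_def using that by (intro q_index_mono_le) auto
  have t_gap: "t i + g \<le> t j" if "i < j" "j < l" for i j
    using gap[of "Suc i"] t_mono_le[of "Suc i" j] that by (simp add: t_def)
  have t_far: "s + R \<le> t j \<or> t j + R \<le> s" if "s \<in> T" "j < l" for s j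
    using far[of s "Suc j"] that by (simp add: t_def)
  define S where "S j = {s \<in> T. s < t j \<and> (\<forall>i<j. t i < s)}" for j
  have S_cover: "(\<Union>j<l. S j) = T"
  proof (intro equalityI subsetI)
    fix s assume s: "s \<in> T"
    have ex: "s < t (l - 1)" using T(2)[OF s] l_pos by (simp add: t_def)
    define j where "j = (LEAST j. s < t j)"
    have j: "s < t j" unfolding j_def using ex by (rule LeastI)
    have "j \<le> l - 1" unfolding j_def using ex by (rule Least_le)
    then have jl: "j < l" using l_pos by simp
    have "t i < s" if "i < j" for i
    proof -
      have "\<not> s < t i" using that not_less_Least unfolding j_def by blast
      moreover have "s \<noteq> t i" using t_far[OF s, of i] that jl R by auto
      ultimately show ?thesis by simp
    qed
    with j jl s show "s \<in> (\<Union>j<l. S j)" by (auto simp: S_def)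
  qed (auto simp: S_def)
  have S_gap: "s + R \<le> s'" if "i < j" "j < l" "s \<in> S i" "s' \<in> S j" for i j s s'
    using that t_far[of s i] t_far[of s' i] unfolding S_def by force
  define B where "B s = (if s \<in> T then D s else A)" for s
  have B: "B s \<in> sets borel" for s using A D by (simp add: B_def)
  have t_notin: "t j \<notin> T" if "j < l" for j using t_far[of "t j" j] that R by auto
  define w where "w = (\<Prod>j<l. prob (cyl (S j) D))"
  have w_nonneg: "0 \<le> w" unfolding w_def by (intro prod_nonneg) simp
  have cylT: "\<bar>prob (cyl T D) - w\<bar> \<le> ((1 + psi (enat R)) ^ l - 1) * w"
    unfolding w_def S_cover[symmetric]
    by (rule block_factorization) (use R S_gap D T(1) in \<open>auto simp: S_def\<close>)
  \<comment> \<open>Even positions carry the pieces of \<open>T\<close>, odd ones the indices of the hit.\<close>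
  define S2 where "S2 k = (if even k then S (k div 2) else {t (k div 2)})" for k
  have gap2: "s + g \<le> s'" if jk: "j < k" "k < 2 * l" and s: "s \<in> S2 j" and s': "s' \<in> S2 k" for j k s s'
  proof -
    have le: "j div 2 \<le> k div 2" "k div 2 < l" using jk by auto
    show ?thesis
    proof (cases "even j")
      case jev: True
      then have sj: "s \<in> S (j div 2)" using s by (simp add: S2_def)
      then have sR: "s + R \<le> t (j div 2)" using t_far[of s "j div 2"] le by (auto simp: S_def)
      show ?thesis
      proof (cases "even k")
        case True
        then have "j div 2 < k div 2" using jev jk by presburger
        then show ?thesis using S_gap[OF _ le(2) sj, of s'] s' True g by (simp add: S2_def)
      next
        case False
        then have "s' = t (k div 2)" using s' by (simp add: S2_def)
        then show ?thesis using sR t_mono_le[OF le] g by simp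
      qed
    next
      case False
      then have sj: "s = t (j div 2)" using s by (simp add: S2_def)
      have lt: "j div 2 < k div 2" using False jk by presburger
      show ?thesis
      proof (cases "even k")
        case True
        then have "s' \<in> S (k div 2)" using s' by (simp add: S2_def)
        then show ?thesis using sj lt le t_far[of s' "j div 2"] g by (force simp: S_def)
      next
        case False
        then have "s' = t (k div 2)" using s' by (simp add: S2_def)
        then show ?thesis using sj t_gap[OF lt le(2)] by simp
      qed
    qed
  qed
  have cover2: "(\<Union>k<2 * l. S2 k) = T \<union> t ` {..<l}"
  proof (intro equalityI subsetI)
    fix s assume "s \<in> (\<Union>k<2 * l. S2 k)"
    then show "s \<in> T \<union> t ` {..<l}" by (auto simp: S2_def S_def split: if_splits)
  next
    fix s assume "s \<in> T \<union> t ` {..<l}"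
    then consider j where "j < l" "s \<in> S j" | j where "j < l" "s = t j"
      using S_cover by blast
    then show "s \<in> (\<Union>k<2 * l. S2 k)"
    proof cases
      case 1
      then show ?thesis by (intro UN_I[of "2 * j"]) (auto simp: S2_def)
    next
      case 2
      then show ?thesis by (intro UN_I[of "2 * j + 1"]) (auto simp: S2_def)
    qed
  qed
  have prod2: "(\<Prod>k<2 * l. prob (cyl (S2 k) B)) = w * law A ^ l"
  proof -
    have "cyl (S j) B = cyl (S j) D" for j
      by (rule cyl_cong) (auto simp: S_def B_def)
    moreover have "(\<Prod>j<l. prob (cyl {t j} B)) = (\<Prod>j<l. law A)"
      using t_notin by (intro prod.cong) (auto simp: prob_cyl_singleton[of B, OF B] B_def)
    ultimately show ?thesis
      unfolding prod_even_odd by (simp add: S2_def w_def)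
  qed
  have event2: "cyl (\<Union>k<2 * l. S2 k) B = {\<omega> \<in> space P. n \<in> hits A \<omega>} \<inter> cyl T D"
  proof -
    have "cyl T B = cyl T D" by (rule cyl_cong) (simp add: B_def)
    moreover have "cyl (t ` {..<l}) B = {\<omega> \<in> space P. n \<in> hits A \<omega>}"
    proof -
      have "t ` {..<l} = (\<lambda>i. q i n) ` {1..l}"
        unfolding t_def image_Suc_lessThan[symmetric] by (simp add: image_image)
      moreover have "cyl (t ` {..<l}) B = cyl (t ` {..<l}) (\<lambda>_. A)"
        using t_notin by (intro cyl_cong) (auto simp: B_def)
      ultimately show ?thesis by (auto simp: cyl_def hits_def)
    qed
    ultimately show ?thesis unfolding cover2 cyl_Un by auto
  qed
  have joint: "\<bar>prob ({\<omega> \<in> space P. n \<in> hits A \<omega>} \<inter> cyl T D) - w * law A ^ l\<bar>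
     \<le> ((1 + psi (enat g)) ^ (2 * l) - 1) * (w * law A ^ l)"
    unfolding event2[symmetric] prod2[symmetric]
    by (rule block_factorization)
      (use g gap2 B T(1) in \<open>auto simp: S2_def S_def\<close>)
  define d where "d = 2 - 2 powr (real l / (real l + 1))"
  have d: "0 < d"
  proof -
    have "2 powr (real l / (real l + 1)) < 2 powr 1"
      by (rule powr_less_mono) (auto simp: field_simps)
    then show ?thesis by (simp add: d_def)
  qed
  have psiRpow: "(1 + psi (enat R)) ^ l - 1 \<le> 1 - d"
  proof -
    have "(1 + psi (enat R)) ^ l \<le> (2 powr (1 / (real l + 1))) ^ l"
      using psiR psi_nonneg[of "enat R"] by (intro power_mono) auto
    also have "\<dots> = 2 powr (real l / (real l + 1))"
      by (simp add: powr_realpow[symmetric] powr_powr)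
    finally show ?thesis by (simp add: d_def)
  qed
  \<comment> \<open>The product \<open>w\<close> is at most a constant times the cylinder probability, so the final bound
    can be summed over disjoint cylinders.\<close>
  have w_le: "d * w \<le> prob (cyl T D)"
  proof -
    have "((1 + psi (enat R)) ^ l - 1) * w \<le> (1 - d) * w"
      by (rule mult_right_mono[OF psiRpow w_nonneg])
    then show ?thesis using cylT by (simp add: algebra_simps)
  qed
  define \<delta> where "\<delta> = (1 + psi (enat g)) ^ (2 * l) - 1"
  have \<delta>_ge: "(1 + psi (enat R)) ^ l - 1 \<le> \<delta>"
  proof -
    have "(1 + psi (enat R)) ^ l \<le> (1 + psi (enat g)) ^ l"
      using psi_mono[OF g] psi_nonneg[of "enat R"] by (intro power_mono) auto
    also have "\<dots> \<le> (1 + psi (enat g)) ^ (2 * l)"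
      using psi_nonneg[of "enat g"] by (intro power_increasing) auto
    finally show ?thesis by (simp add: \<delta>_def)
  qed
  have \<delta>_le: "\<delta> \<le> 2 * real l * (1 + psi 1) ^ (2 * l) * (psi (enat R) + psi (min_gap l q n))"
  proof -
    have "\<delta> \<le> real (2 * l) * psi (enat g) * (1 + psi (enat g)) ^ (2 * l)"
      unfolding \<delta>_def by (rule power_minus_1_le[OF psi_nonneg])
    also have "\<dots> \<le> real (2 * l) * (psi (enat R) + psi (min_gap l q n)) * (1 + psi 1) ^ (2 * l)"
      using psig psi_le_psi_1[of "enat g"] g psi_nonneg[of "enat g"]
      by (intro mult_mono power_mono mult_left_mono) (auto simp: one_enat_def)
    finally show ?thesis by (simp only: of_nat_mult of_nat_numeral mult.commute mult.left_commute mult.assoc)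
  qed
  have QA: "0 \<le> law A ^ l" using law_nonneg by simp
  have "w * law A ^ l - law A ^ l * prob (cyl T D) = - (law A ^ l * (prob (cyl T D) - w))"
    by (simp add: algebra_simps)
  then have "\<bar>w * law A ^ l - law A ^ l * prob (cyl T D)\<bar> = law A ^ l * \<bar>prob (cyl T D) - w\<bar>"
    using QA by (simp add: abs_mult)
  also have "\<dots> \<le> law A ^ l * (\<delta> * w)"
    using cylT mult_right_mono[OF \<delta>_ge w_nonneg] by (intro mult_left_mono[OF _ QA]) simp
  finally have "\<bar>prob ({\<omega> \<in> space P. n \<in> hits A \<omega>} \<inter> cyl T D) - law A ^ l * prob (cyl T D)\<bar>
      \<le> 2 * \<delta> * law A ^ l * w"
    using joint unfolding \<delta>_def[symmetric] by (simp add: algebra_simps)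
  also have "\<dots> \<le> 2 * \<delta> * law A ^ l * (prob (cyl T D) / d)"
  proof (rule mult_left_mono)
    show "w \<le> prob (cyl T D) / d" using w_le d by (simp add: field_simps)
    have "0 \<le> \<delta>" unfolding \<delta>_def using psi_nonneg[of "enat g"] by (simp add: one_le_power)
    then show "0 \<le> 2 * \<delta> * law A ^ l" using QA by simp
  qed
  also have "\<dots> = \<delta> * (2 * law A ^ l * prob (cyl T D) / d)" by simp
  also have "\<dots> \<le> (2 * real l * (1 + psi 1) ^ (2 * l) * (psi (enat R) + psi (min_gap l q n)))
      * (2 * law A ^ l * prob (cyl T D) / d)"
    by (rule mult_right_mono[OF \<delta>_le]) (use d QA in simp)
  also have "\<dots> = decoupling_const * (psi (enat R) + psi (min_gap l q n)) * law A ^ l * prob (cyl T D)"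
    by (simp add: decoupling_const_def d_def)
  finally show ?thesis .
qed

lemma hits_event [measurable]:
  assumes [measurable]: "A \<in> sets borel"
  shows "{\<omega> \<in> space P. n \<in> hits A \<omega>} \<in> events"
  unfolding hits_def by measurable

lemma decoupling_const_nonneg: "0 \<le> decoupling_const"
proof -
  have "2 powr (real l / (real l + 1)) < 2 powr 1"
    by (rule powr_less_mono) (auto simp: field_simps)
  then show ?thesis
    unfolding decoupling_const_def using psi_nonneg[of 1] by simp
qed

text \<open>
  A hit pattern over \<open>N\<close> is determined by finitely many indices \<open>T\<close> and, at each of them, by membership
  in \<open>B\<close> and in \<open>B'\<close>. The resulting cylinder events partition the space and \<open>F\<close> is constant on each,
  so summing \<open>cell_estimate\<close> over the cells costs only the total probability 1.
\<close>

lemma far_past_decoupling: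
  fixes F :: "nat set \<Rightarrow> nat set \<Rightarrow> real"
  assumes R: "1 \<le> R" and psiR: "psi (enat R) < 2 powr (1 / (real l + 1)) - 1"
    and A: "A \<in> sets borel" and B: "B \<in> sets borel" "B' \<in> sets borel"
    and N: "N \<subseteq> {..<n} - near R n"
    and F: "\<And>a b. \<bar>F a b\<bar> \<le> 1"
  shows "\<bar>expectation (\<lambda>\<omega>. (of_bool (n \<in> hits A \<omega>) - law A ^ l) * F (hits B \<omega> \<inter> N) (hits B' \<omega> \<inter> N))\<bar>
     \<le> decoupling_const * (psi (enat R) + psi (min_gap l q n)) * law A ^ l"
proof -
  define T where "T = (\<lambda>(i, m). q i m) ` ({1..l} \<times> N)"
  have finN: "finite N" by (rule finite_subset[OF N]) simp
  then have finT: "finite T" by (simp add: T_def)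
  have T_less: "s < q l n" if "s \<in> T" for s
  proof -
    obtain j m where "j \<in> {1..l}" "m \<in> N" "s = q j m" using \<open>s \<in> T\<close> by (auto simp: T_def)
    then show ?thesis using N q_past_less[of m n j] by auto
  qed
  have far: "s + R \<le> q i n \<or> q i n + R \<le> s" if "s \<in> T" "i \<in> {1..l}" for s i
  proof -
    obtain j m where jm: "j \<in> {1..l}" "m \<in> N" "s = q j m" using \<open>s \<in> T\<close> by (auto simp: T_def)
    then have "m < n" "m \<notin> near R n" using N by auto
    then show ?thesis using jm that(2) unfolding near_def by force
  qed
  define \<Phi> where "\<Phi> = (T \<rightarrow>\<^sub>E (UNIV :: (bool \<times> bool) set))"
  have fin\<Phi>: "finite \<Phi>" unfolding \<Phi>_def by (intro finite_PiE finT) simp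
  \<comment> \<open>The cell of \<open>\<omega>\<close> is the function that records both memberships at every index in \<open>T\<close>.\<close>
  define lab where "lab \<omega> = restrict (\<lambda>s. (\<xi> s \<omega> \<in> B, \<xi> s \<omega> \<in> B')) T" for \<omega>
  have lab: "lab \<omega> \<in> \<Phi>" for \<omega> by (simp add: lab_def \<Phi>_def)
  define D where "D \<phi> s = {x. (x \<in> B, x \<in> B') = \<phi> s}" for \<phi> :: "nat \<Rightarrow> bool \<times> bool" and s
  have D: "D \<phi> s \<in> sets borel" for \<phi> s
  proof -
    have "D \<phi> s = (if fst (\<phi> s) then B else - B) \<inter> (if snd (\<phi> s) then B' else - B')"
      by (auto simp: D_def prod_eq_iff)
    then show ?thesis using B by auto
  qed
  have cyl_lab: "cyl T (D \<phi>) = {\<omega> \<in> space P. lab \<omega> = \<phi>}" if "\<phi> \<in> \<Phi>" for \<phi>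
    using that by (auto simp: cyl_def D_def lab_def \<Phi>_def fun_eq_iff restrict_def PiE_def extensional_def)
  define G where "G \<phi> = F {m \<in> N. \<forall>i\<in>{1..l}. fst (\<phi> (q i m))} {m \<in> N. \<forall>i\<in>{1..l}. snd (\<phi> (q i m))}"
    for \<phi> :: "nat \<Rightarrow> bool \<times> bool"
  have G_lab: "F (hits B \<omega> \<inter> N) (hits B' \<omega> \<inter> N) = G (lab \<omega>)" for \<omega>
  proof -
    have *: "lab \<omega> (q i m) = (\<xi> (q i m) \<omega> \<in> B, \<xi> (q i m) \<omega> \<in> B')" if "m \<in> N" "i \<in> {1..l}" for i m
      using that by (auto simp: lab_def T_def)
    have "hits B \<omega> \<inter> N = {m \<in> N. \<forall>i\<in>{1..l}. fst (lab \<omega> (q i m))}"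
      "hits B' \<omega> \<inter> N = {m \<in> N. \<forall>i\<in>{1..l}. snd (lab \<omega> (q i m))}"
      using * by (auto simp: hits_def)
    then show ?thesis by (simp add: G_def)
  qed
  define X where "X = {\<omega> \<in> space P. n \<in> hits A \<omega>}"
  have X: "X \<in> events" unfolding X_def using A by simp
  have cyl_ev: "cyl T (D \<phi>) \<in> events" for \<phi> by (rule sets_cyl[OF finT D])
  let ?p = "law A ^ l"
  let ?K = "decoupling_const * (psi (enat R) + psi (min_gap l q n)) * ?p"
  have "expectation (\<lambda>\<omega>. (of_bool (n \<in> hits A \<omega>) - ?p) * F (hits B \<omega> \<inter> N) (hits B' \<omega> \<inter> N))
      = expectation (\<lambda>\<omega>. \<Sum>\<phi>\<in>\<Phi>. G \<phi> * (indicator (X \<inter> cyl T (D \<phi>)) \<omega> - ?p * indicator (cyl T (D \<phi>)) \<omega>))"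
  proof (rule Bochner_Integration.integral_cong[OF refl])
    fix \<omega> assume \<omega>: "\<omega> \<in> space P"
    have "(\<Sum>\<phi>\<in>\<Phi>. G \<phi> * (indicator (X \<inter> cyl T (D \<phi>)) \<omega> - ?p * indicator (cyl T (D \<phi>)) \<omega>))
        = (\<Sum>\<phi>\<in>\<Phi>. if lab \<omega> = \<phi> then G \<phi> * (of_bool (n \<in> hits A \<omega>) - ?p) else 0)"
      by (rule sum.cong[OF refl]) (use \<omega> in \<open>auto simp: cyl_lab X_def indicator_def\<close>)
    also have "\<dots> = G (lab \<omega>) * (of_bool (n \<in> hits A \<omega>) - ?p)"
      using lab fin\<Phi> by simp
    finally show "(of_bool (n \<in> hits A \<omega>) - ?p) * F (hits B \<omega> \<inter> N) (hits B' \<omega> \<inter> N)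
      = (\<Sum>\<phi>\<in>\<Phi>. G \<phi> * (indicator (X \<inter> cyl T (D \<phi>)) \<omega> - ?p * indicator (cyl T (D \<phi>)) \<omega>))"
      by (simp add: G_lab)
  qed
  also have "\<dots> = (\<Sum>\<phi>\<in>\<Phi>. G \<phi> * (prob (X \<inter> cyl T (D \<phi>)) - ?p * prob (cyl T (D \<phi>))))"
    using X cyl_ev by (simp add: emeasure_eq_measure)
  finally have "\<bar>expectation (\<lambda>\<omega>. (of_bool (n \<in> hits A \<omega>) - ?p) * F (hits B \<omega> \<inter> N) (hits B' \<omega> \<inter> N))\<bar>
      \<le> (\<Sum>\<phi>\<in>\<Phi>. \<bar>G \<phi> * (prob (X \<inter> cyl T (D \<phi>)) - ?p * prob (cyl T (D \<phi>)))\<bar>)"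
    by simp
  also have "\<dots> \<le> (\<Sum>\<phi>\<in>\<Phi>. 1 * (?K * prob (cyl T (D \<phi>))))"
    unfolding abs_mult X_def
    by (intro sum_mono mult_mono cell_estimate[OF R psiR A D finT T_less far])
      (use F in \<open>auto simp: G_def\<close>)
  also have "\<dots> = ?K * (\<Sum>\<phi>\<in>\<Phi>. prob (cyl T (D \<phi>)))"
    by (simp add: sum_distrib_left)
  also have "(\<Sum>\<phi>\<in>\<Phi>. prob (cyl T (D \<phi>))) = prob (\<Union>\<phi>\<in>\<Phi>. cyl T (D \<phi>))"
  proof (rule finite_measure_finite_Union[symmetric])
    show "(\<lambda>\<phi>. cyl T (D \<phi>)) ` \<Phi> \<subseteq> events" using cyl_ev by blast
  qed (use fin\<Phi> in \<open>auto simp: disjoint_family_on_def cyl_lab\<close>)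
  also have "?K * \<dots> \<le> ?K * 1"
    by (rule mult_left_mono[OF prob_le_1])
      (auto intro!: mult_nonneg_nonneg add_nonneg_nonneg zero_le_power decoupling_const_nonneg psi_nonneg law_nonneg)
  finally show ?thesis by simp
qed

text \<open>
  The index \<open>q\<^sub>l(n)\<close> exceeds all \<open>l\<close> indices of a hit at \<open>m < n\<close>, so the two hits together constrain at
  least \<open>l + 1\<close> distinct indices. The last factor \<open>law A\<close> is what makes nearby pairs of hits rare.
\<close>

lemma prob_two_hits:
  assumes "m < n" and A: "A \<in> sets borel" and B: "B \<in> sets borel"
  shows "prob {\<omega> \<in> space P. m \<in> hits B \<omega> \<and> n \<in> hits A \<omega>} \<le> (1 + psi 1) ^ (l + 1) * (law B ^ l * law A)"
proof -
  define t where "t j = (if j < l then q (Suc j) m else q l n)" for j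
  have t_mono: "t i < t j" if "i < j" "j < Suc l" for i j
    using that q_index_mono[of "Suc i" "Suc j" m] q_past_less[OF \<open>m < n\<close>, of "Suc i"]
    by (auto simp: t_def)
  define C where "C s = (if s = q l n then A else B)" for s
  have C: "C s \<in> sets borel" for s using A B by (simp add: C_def)
  have tl: "t j \<noteq> q l n" if "j < l" for j using t_mono[of j l] that by (simp add: t_def)
  have "\<bar>prob (cyl (\<Union>k<Suc l. {t k}) C) - (\<Prod>k<Suc l. prob (cyl {t k} C))\<bar>
      \<le> ((1 + psi (enat 1)) ^ Suc l - 1) * (\<Prod>k<Suc l. prob (cyl {t k} C))"
    by (rule block_factorization) (use t_mono C in \<open>auto simp: Suc_le_eq\<close>)
  moreover have "(\<Prod>k<Suc l. prob (cyl {t k} C)) = law B ^ l * law A"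
  proof -
    have "(\<Prod>k<l. prob (cyl {t k} C)) = (\<Prod>k<l. law B)"
      using tl by (intro prod.cong) (auto simp: prob_cyl_singleton[of C, OF C] C_def)
    moreover have "prob (cyl {t l} C) = law A"
      by (simp add: prob_cyl_singleton[of C, OF C] C_def t_def)
    ultimately show ?thesis by simp
  qed
  ultimately have "prob (cyl (\<Union>k<Suc l. {t k}) C) \<le> (1 + psi 1) ^ (l + 1) * (law B ^ l * law A)"
    by (simp add: one_enat_def algebra_simps)
  moreover have "{\<omega> \<in> space P. m \<in> hits B \<omega> \<and> n \<in> hits A \<omega>} \<subseteq> cyl (\<Union>k<Suc l. {t k}) C"
    using tl l_pos by (auto simp: cyl_def hits_def C_def t_def less_Suc_eq)
  moreover have "cyl (\<Union>k<Suc l. {t k}) C \<in> events" by (rule sets_cyl) (use C in auto)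
  ultimately show ?thesis by (meson finite_measure_mono order_trans)
qed

lemma prob_hit:
  assumes A: "A \<in> sets borel"
  shows "prob {\<omega> \<in> space P. n \<in> hits A \<omega>} \<le> (1 + psi 1) ^ (l + 1) * law A ^ l"
proof -
  have total: "law UNIV = 1" using marginal[of UNIV 0] prob_space by simp
  \<comment> \<open>A single hit is a pair of hits whose later member is unconstrained.\<close>
  have "prob {\<omega> \<in> space P. n \<in> hits A \<omega>}
      = prob {\<omega> \<in> space P. n \<in> hits A \<omega> \<and> Suc n \<in> hits UNIV \<omega>}"
    by (simp add: hits_def)
  also have "\<dots> \<le> (1 + psi 1) ^ (l + 1) * law A ^ l"
    using prob_two_hits[of n "Suc n" UNIV A] A total by simp
  finally show ?thesis .
qed

text \<open>
  The first summand is the cost of decoupling from the far past, the second that of discarding the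
  near hits.
\<close>

definition past_error :: "nat \<Rightarrow> real set \<Rightarrow> real set \<Rightarrow> real set \<Rightarrow> nat \<Rightarrow> real" where
  "past_error R A B B' n = decoupling_const * (psi (enat R) + psi (min_gap l q n)) * law A ^ l
     + 2 * (real l * (real l * (2 * real R))) * (2 * ((1 + psi 1) ^ (l + 1) * (law A * (law B ^ l + law B' ^ l))))"

lemma measurable_hit_pattern:
  fixes F :: "nat set \<Rightarrow> nat set \<Rightarrow> real"
  assumes N: "finite N" and B: "B \<in> sets borel" "B' \<in> sets borel"
  shows "(\<lambda>\<omega>. F (hits B \<omega> \<inter> N) (hits B' \<omega> \<inter> N)) \<in> borel_measurable P"
proof -
  have part: "(\<lambda>\<omega>. hits D \<omega> \<inter> N) \<in> measurable P (count_space (Pow N))" if [measurable]: "D \<in> sets borel" for D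
  proof (subst measurable_count_space_eq2)
    show "finite (Pow N)" using N by simp
    have "(\<lambda>\<omega>. hits D \<omega> \<inter> N) -` {a} \<inter> space P \<in> events" if "a \<in> Pow N" for a
    proof -
      have "(\<lambda>\<omega>. hits D \<omega> \<inter> N) -` {a} \<inter> space P = {\<omega> \<in> space P. \<forall>m\<in>N. (m \<in> hits D \<omega>) = (m \<in> a)}"
        using that by auto
      also have "\<dots> \<in> events"
        by (rule sets.sets_Collect_finite_All[OF _ N]) (simp add: hits_def)
      finally show ?thesis .
    qed
    then show "(\<lambda>\<omega>. hits D \<omega> \<inter> N) \<in> space P \<rightarrow> Pow N \<and>
        (\<forall>a\<in>Pow N. (\<lambda>\<omega>. hits D \<omega> \<inter> N) -` {a} \<inter> space P \<in> events)"
      by auto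
  qed
  have "(\<lambda>\<omega>. (\<lambda>a \<omega>. F a (hits B' \<omega> \<inter> N)) (hits B \<omega> \<inter> N) \<omega>) \<in> borel_measurable P"
    by (rule measurable_compose_countable'[OF _ part[OF B(1)]])
      (use N in \<open>auto intro!: measurable_compose[OF part[OF B(2)]] countable_finite\<close>)
  then show ?thesis .
qed

text \<open>
  Deleting the near hits changes the value of \<open>F\<close> only if one of them occurs, and then by at most 2. The
  expected change is thus bounded by the probabilities of a near hit jointly with a hit at \<open>n\<close>, and
  of a near hit times \<open>law A ^ l\<close>.
\<close>

lemma past_decoupling:
  fixes F :: "nat set \<Rightarrow> nat set \<Rightarrow> real"
  assumes R: "1 \<le> R" and psiR: "psi (enat R) < 2 powr (1 / (real l + 1)) - 1"
    and A[measurable]: "A \<in> sets borel" and B[measurable]: "B \<in> sets borel" "B' \<in> sets borel"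
    and F: "\<And>a b. \<bar>F a b\<bar> \<le> 1"
  shows "\<bar>expectation (\<lambda>\<omega>. (of_bool (n \<in> hits A \<omega>) - law A ^ l) * F (hits B \<omega> \<inter> {..<n}) (hits B' \<omega> \<inter> {..<n}))\<bar>
     \<le> past_error R A B B' n"
proof -
  define N where "N = {..<n} - near R n"
  have [measurable]: "(\<lambda>\<omega>. F (hits B \<omega> \<inter> {..<n}) (hits B' \<omega> \<inter> {..<n})) \<in> borel_measurable P"
    "(\<lambda>\<omega>. F (hits B \<omega> \<inter> N) (hits B' \<omega> \<inter> N)) \<in> borel_measurable P"
    by (rule measurable_hit_pattern; use B in \<open>simp add: N_def\<close>)+
  let ?Z = "\<lambda>\<omega>. (of_bool (n \<in> hits A \<omega>) - law A ^ l) * F (hits B \<omega> \<inter> {..<n}) (hits B' \<omega> \<inter> {..<n})"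
  let ?Z' = "\<lambda>\<omega>. (of_bool (n \<in> hits A \<omega>) - law A ^ l) * F (hits B \<omega> \<inter> N) (hits B' \<omega> \<inter> N)"
  let ?c = "(1 + psi 1) ^ (l + 1)"
  let ?both = "\<lambda>D m. {\<omega> \<in> space P. m \<in> hits D \<omega> \<and> n \<in> hits A \<omega>}"
  let ?one = "\<lambda>D m. {\<omega> \<in> space P. m \<in> hits D \<omega>}"
  let ?W = "\<lambda>\<omega>. \<Sum>m\<in>near R n. 2 * (\<Sum>D\<leftarrow>[B, B']. indicator (?both D m) \<omega> + law A ^ l * indicator (?one D m) \<omega>)"
  have fin: "finite (near R n)" by (rule finite_subset[of _ "{..<n}"]) (auto simp: near_def)
  have QA: "0 \<le> law A ^ l" "law A ^ l \<le> law A" "law A ^ l \<le> 1"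
    using law_nonneg[of A] law_le_1[of A] power_decreasing[of 1 l "law A"] l_pos by (auto simp: power_le_one)
  have meas_both[measurable]: "?both D m \<in> events" if [measurable]: "D \<in> sets borel" for D m
    unfolding hits_def by measurable
  have Zb: "\<bar>?Z \<omega>\<bar> \<le> 1" "\<bar>?Z' \<omega>\<bar> \<le> 1" for \<omega>
    unfolding abs_mult using QA F by (auto intro!: mult_le_one)
  have int: "integrable P ?Z" "integrable P ?Z'"
    by (rule integrable_const_bound[where B=1]; use Zb in \<open>auto\<close>; fail)+
  have "\<bar>expectation (\<lambda>\<omega>. ?Z \<omega> - ?Z' \<omega>)\<bar> \<le> expectation (\<lambda>\<omega>. \<bar>?Z \<omega> - ?Z' \<omega>\<bar>)"
    by simp
  also have "\<dots> \<le> expectation ?W"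
  proof (rule integral_mono)
    fix \<omega> assume \<omega>: "\<omega> \<in> space P"
    show "\<bar>?Z \<omega> - ?Z' \<omega>\<bar> \<le> ?W \<omega>"
    proof (cases "\<exists>m\<in>near R n. m \<in> hits B \<omega> \<or> m \<in> hits B' \<omega>")
      case False
      then have "hits B \<omega> \<inter> {..<n} = hits B \<omega> \<inter> N" "hits B' \<omega> \<inter> {..<n} = hits B' \<omega> \<inter> N"
        by (auto simp: N_def)
      then have "\<bar>?Z \<omega> - ?Z' \<omega>\<bar> = 0" by simp
      also have "0 \<le> ?W \<omega>" using QA by (intro sum_nonneg) simp
      finally show ?thesis .
    next
      case True
      then obtain m where m: "m \<in> near R n" "m \<in> hits B \<omega> \<or> m \<in> hits B' \<omega>" by blast
      let ?w = "\<lambda>m. 2 * (\<Sum>D\<leftarrow>[B, B']. indicator (?both D m) \<omega> + law A ^ l * indicator (?one D m) \<omega>)"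
      have "\<bar>?Z \<omega> - ?Z' \<omega>\<bar> = \<bar>of_bool (n \<in> hits A \<omega>) - law A ^ l\<bar>
          * \<bar>F (hits B \<omega> \<inter> {..<n}) (hits B' \<omega> \<inter> {..<n}) - F (hits B \<omega> \<inter> N) (hits B' \<omega> \<inter> N)\<bar>"
        unfolding abs_mult[symmetric] by (simp add: algebra_simps)
      also have "\<dots> \<le> (of_bool (n \<in> hits A \<omega>) + law A ^ l) * 2"
        using QA F[of "hits B \<omega> \<inter> {..<n}" "hits B' \<omega> \<inter> {..<n}"] F[of "hits B \<omega> \<inter> N" "hits B' \<omega> \<inter> N"]
        by (intro mult_mono) (auto simp: abs_if split: if_splits)
      also have "\<dots> \<le> ?w m"
        using m \<omega> QA by (auto simp: indicator_def)
      also have "\<dots> \<le> sum ?w (near R n)"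
        by (rule member_le_sum[OF m(1)]) (use QA fin in auto)
      finally show ?thesis .
    qed
  qed (use int B in \<open>auto simp: emeasure_eq_measure\<close>)
  also have "\<dots> = (\<Sum>m\<in>near R n. 2 * (\<Sum>D\<leftarrow>[B, B']. prob (?both D m) + law A ^ l * prob (?one D m)))"
    using B by (simp add: emeasure_eq_measure)
  also have "\<dots> \<le> (\<Sum>m\<in>near R n. 2 * (\<Sum>D\<leftarrow>[B, B']. 2 * (?c * (law A * law D ^ l))))"
  proof (intro sum_mono mult_left_mono sum_list_mono)
    fix m D assume "m \<in> near R n" "D \<in> set [B, B']"
    then have m: "m < n" and D: "D \<in> sets borel" using B by (auto simp: near_def)
    have "prob (?both D m) \<le> ?c * (law D ^ l * law A)" by (rule prob_two_hits[OF m A D])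
    moreover have "law A ^ l * prob (?one D m) \<le> law A * (?c * law D ^ l)"
      by (rule mult_mono[OF QA(2) prob_hit[OF D]]) (auto intro: law_nonneg)
    ultimately show "prob (?both D m) + law A ^ l * prob (?one D m) \<le> 2 * (?c * (law A * law D ^ l))"
      by (simp add: mult_ac)
  qed simp
  also have "\<dots> = real (card (near R n)) * (2 * (2 * (?c * (law A * (law B ^ l + law B' ^ l)))))"
    by (simp add: algebra_simps)
  also have "\<dots> \<le> (real l * (real l * (2 * real R))) * (2 * (2 * (?c * (law A * (law B ^ l + law B' ^ l)))))"
  proof (rule mult_right_mono)
    show "real (card (near R n)) \<le> real l * (real l * (2 * real R))"
      using card_near[of R n] by (metis of_nat_le_iff of_nat_mult of_nat_numeral)
  qed (use law_nonneg psi_nonneg[of 1] in \<open>auto intro!: mult_nonneg_nonneg add_nonneg_nonneg\<close>)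
  finally have "\<bar>expectation ?Z - expectation ?Z'\<bar>
      \<le> (real l * (real l * (2 * real R))) * (2 * (2 * (?c * (law A * (law B ^ l + law B' ^ l)))))"
    using int by simp
  moreover have "\<bar>expectation ?Z'\<bar> \<le> decoupling_const * (psi (enat R) + psi (min_gap l q n)) * law A ^ l"
    by (rule far_past_decoupling[OF R psiR A B _ F]) (simp add: N_def)
  ultimately show ?thesis unfolding past_error_def by (simp add: algebra_simps)
qed

section \<open>The stopped count\<close>

lemma hits_disjoint:
  assumes "\<Gamma> \<inter> \<Gamma>' = {}"
  shows "hits \<Gamma> \<omega> \<inter> hits \<Gamma>' \<omega> = {}"
proof -
  have "1 \<in> {1..l}" using l_pos by simp
  then show ?thesis using assms unfolding hits_def by blast
qed

lemma hit_eq_of_bool: "hit \<xi> l q \<Gamma> n \<omega> = of_bool (n \<in> hits \<Gamma> \<omega>)"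
proof (cases "n \<in> hits \<Gamma> \<omega>")
  case True
  then show ?thesis by (simp add: hit_def hits_def)
next
  case False
  then obtain i where "i \<in> {1..l}" "\<xi> (q i n) \<omega> \<notin> \<Gamma>" by (auto simp: hits_def)
  then have "hit \<xi> l q \<Gamma> n \<omega> = 0"
    unfolding hit_def by (intro prod_zero bexI[of _ i]) auto
  with False show ?thesis by simp
qed

lemma hit_time_gt_iff: "enat n < hit_time \<xi> l q \<Gamma> \<omega> \<longleftrightarrow> hits \<Gamma> \<omega> \<inter> {..n} = {}"
proof -
  have *: "hit_time \<xi> l q \<Gamma> \<omega> = Inf (enat ` hits \<Gamma> \<omega>)"
    by (auto simp: hit_time_def hit_eq_of_bool intro!: arg_cong[where f=Inf])
  have "hit_time \<xi> l q \<Gamma> \<omega> \<le> enat n \<longleftrightarrow> (\<exists>m\<in>hits \<Gamma> \<omega>. m \<le> n)"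
  proof
    assume le: "hit_time \<xi> l q \<Gamma> \<omega> \<le> enat n"
    then have "enat ` hits \<Gamma> \<omega> \<noteq> {}" unfolding * by (auto simp: top_enat_def)
    then have "hit_time \<xi> l q \<Gamma> \<omega> \<in> enat ` hits \<Gamma> \<omega>" unfolding * by (rule wellorder_InfI[OF ex_in_conv[THEN iffD2, THEN someI_ex]])
    then show "\<exists>m\<in>hits \<Gamma> \<omega>. m \<le> n" using le by auto
  next
    assume "\<exists>m\<in>hits \<Gamma> \<omega>. m \<le> n"
    then show "hit_time \<xi> l q \<Gamma> \<omega> \<le> enat n" unfolding * by (auto intro: Inf_lower2)
  qed
  then show ?thesis by (auto simp: not_le[symmetric])
qed

lemma stopped_count_eq_card:
  assumes "hits \<Gamma>0 \<omega> \<noteq> {}"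
  shows "stopped_count \<xi> l q \<Gamma>0 \<Gamma>1 \<omega> = ereal (real (card (hits \<Gamma>1 \<omega> \<inter> {..<(LEAST m. m \<in> hits \<Gamma>0 \<omega>)})))"
proof -
  define L where "L = (LEAST m. m \<in> hits \<Gamma>0 \<omega>)"
  have L: "L \<in> hits \<Gamma>0 \<omega>" unfolding L_def using assms by (auto intro: LeastI)
  have "enat n < hit_time \<xi> l q \<Gamma>0 \<omega> \<longleftrightarrow> n < L" for n
    unfolding hit_time_gt_iff using L not_less_Least[of _ "\<lambda>m. m \<in> hits \<Gamma>0 \<omega>"]
    unfolding L_def[symmetric] by (force simp: not_less)
  then have "stopped_count \<xi> l q \<Gamma>0 \<Gamma>1 \<omega> = (\<Sum>n. if n < L then ereal (of_bool (n \<in> hits \<Gamma>1 \<omega>)) else 0)"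
    unfolding stopped_count_def hit_count_def hit_eq_of_bool by simp
  also have "\<dots> = (\<Sum>n<L. if n < L then ereal (of_bool (n \<in> hits \<Gamma>1 \<omega>)) else 0)"
    by (rule suminf_finite) auto
  also have "\<dots> = ereal (\<Sum>n<L. of_bool (n \<in> hits \<Gamma>1 \<omega>))"
    unfolding sum_ereal[symmetric] by (rule sum.cong) auto
  also have "(\<Sum>n<L. of_bool (n \<in> hits \<Gamma>1 \<omega>)) = real (card (hits \<Gamma>1 \<omega> \<inter> {..<L}))"
    by (simp add: Int_commute)
  finally show ?thesis by (simp add: L_def)
qed

lemma measurable_stopped_count:
  assumes [measurable]: "\<Gamma>0 \<in> sets borel" "\<Gamma>1 \<in> sets borel"
  shows "stopped_count \<xi> l q \<Gamma>0 \<Gamma>1 \<in> borel_measurable P"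
proof -
  have [measurable]: "Measurable.pred P (\<lambda>\<omega>. hits \<Gamma>0 \<omega> \<inter> {..n} = {})" for n
  proof -
    have "(\<lambda>\<omega>. hits \<Gamma>0 \<omega> \<inter> {..n} = {}) = (\<lambda>\<omega>. \<forall>m\<in>{..n}. \<not> (\<forall>i\<in>{1..l}. \<xi> (q i m) \<omega> \<in> \<Gamma>0))"
      by (auto simp: hits_def)
    then show ?thesis by simp
  qed
  have [measurable]: "Measurable.pred P (\<lambda>\<omega>. n \<in> hits \<Gamma>1 \<omega>)" for n
    unfolding hits_def by simp
  show ?thesis
    unfolding stopped_count_def hit_count_def hit_time_gt_iff hit_eq_of_bool by measurable
qed

lemma integrable_pattern:
  fixes F :: "nat set \<Rightarrow> nat set \<Rightarrow> real"
  assumes [measurable]: "A \<in> sets borel" and B: "B \<in> sets borel" "B' \<in> sets borel"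
    and F: "\<And>a b. \<bar>F a b\<bar> \<le> 1"
  shows "integrable P (\<lambda>\<omega>. (of_bool (n \<in> hits A \<omega>) - law A ^ l) * F (hits B \<omega> \<inter> {..<n}) (hits B' \<omega> \<inter> {..<n}))"
proof (rule integrable_const_bound[where B=1])
  have [measurable]: "(\<lambda>\<omega>. F (hits B \<omega> \<inter> {..<n}) (hits B' \<omega> \<inter> {..<n})) \<in> borel_measurable P"
    by (rule measurable_hit_pattern[OF _ B]) simp
  have [measurable]: "Measurable.pred P (\<lambda>\<omega>. n \<in> hits A \<omega>)"
    unfolding hits_def by simp
  show "(\<lambda>\<omega>. (of_bool (n \<in> hits A \<omega>) - law A ^ l) * F (hits B \<omega> \<inter> {..<n}) (hits B' \<omega> \<inter> {..<n}))
      \<in> borel_measurable P" by measurable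
  have "0 \<le> law A ^ l" "law A ^ l \<le> 1"
    using law_nonneg[of A] law_le_1[of A] by (auto simp: power_le_one)
  then show "AE \<omega> in P. norm ((of_bool (n \<in> hits A \<omega>) - law A ^ l)
      * F (hits B \<omega> \<inter> {..<n}) (hits B' \<omega> \<inter> {..<n})) \<le> 1"
    unfolding real_norm_def abs_mult using F by (intro AE_I2 mult_le_one) auto
qed

text \<open>
  The probability of having no hazard before \<open>n\<close>, times \<open>(1 - p)\<^sup>M\<^sup>-\<^sup>n\<close>, would not depend on \<open>n\<close> if the
  hazards were independent; the telescoping sum of its increments consists of terms covered by
  \<open>past_decoupling\<close>.
\<close>

lemma survival_bound:
  assumes R: "1 \<le> R" and psiR: "psi (enat R) < 2 powr (1 / (real l + 1)) - 1"
    and B: "\<Gamma>0 \<in> sets borel" "\<Gamma>1 \<in> sets borel"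
  shows "prob {\<omega> \<in> space P. hits \<Gamma>0 \<omega> \<inter> {..<M} = {}}
     \<le> (1 - law \<Gamma>0 ^ l) ^ M + (\<Sum>n<M. past_error R \<Gamma>0 \<Gamma>0 \<Gamma>1 n)"
proof -
  define p where "p = law \<Gamma>0 ^ l"
  have p: "0 \<le> p" "p \<le> 1"
    unfolding p_def using law_nonneg[of \<Gamma>0] law_le_1[of \<Gamma>0] by (auto simp: power_le_one)
  define F where "F n a b = of_bool (a = {}) * (1 - p) ^ (M - Suc n)" for n and a b :: "nat set"
  have F: "\<bar>F n a b\<bar> \<le> 1" for n a b using p by (auto simp: F_def power_le_one)
  let ?Z = "\<lambda>n \<omega>. (of_bool (n \<in> hits \<Gamma>0 \<omega>) - p) * F n (hits \<Gamma>0 \<omega> \<inter> {..<n}) (hits \<Gamma>1 \<omega> \<inter> {..<n})"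
  define W where "W n \<omega> = of_bool (hits \<Gamma>0 \<omega> \<inter> {..<n} = {}) * (1 - p) ^ (M - n)" for n \<omega>
  have step: "W (Suc n) \<omega> - W n \<omega> = - ?Z n \<omega>" if "n < M" for n \<omega>
  proof -
    have "M - n = Suc (M - Suc n)" using that by simp
    then show ?thesis by (auto simp: W_def F_def lessThan_Suc algebra_simps)
  qed
  have WM: "of_bool (hits \<Gamma>0 \<omega> \<inter> {..<M} = {}) = (1 - p) ^ M - (\<Sum>n<M. ?Z n \<omega>)" for \<omega>
  proof -
    have "(\<Sum>n<M. - ?Z n \<omega>) = (\<Sum>n<M. W (Suc n) \<omega> - W n \<omega>)"
      using step by (intro sum.cong) auto
    also have "\<dots> = W M \<omega> - W 0 \<omega>" by (rule sum_lessThan_telescope)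
    finally show ?thesis by (simp add: W_def sum_negf)
  qed
  have int: "integrable P (?Z n)" for n
    unfolding p_def by (rule integrable_pattern[OF B(1) B F])
  have "prob {\<omega> \<in> space P. hits \<Gamma>0 \<omega> \<inter> {..<M} = {}}
      = expectation (indicator {\<omega> \<in> space P. hits \<Gamma>0 \<omega> \<inter> {..<M} = {}})"
    unfolding Bochner_Integration.integral_indicator by (rule arg_cong[where f = prob]) auto
  also have "\<dots> = expectation (\<lambda>\<omega>. (1 - p) ^ M - (\<Sum>n<M. ?Z n \<omega>))"
    by (rule Bochner_Integration.integral_cong) (auto simp: WM[symmetric] indicator_def)
  also have "\<dots> = (1 - p) ^ M - (\<Sum>n<M. expectation (?Z n))"
    using int by (simp add: prob_space)
  also have "\<dots> \<le> (1 - p) ^ M + (\<Sum>n<M. \<bar>expectation (?Z n)\<bar>)"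
    using sum_abs[of "\<lambda>n. expectation (?Z n)" "{..<M}"] by linarith
  also have "\<dots> \<le> (1 - p) ^ M + (\<Sum>n<M. past_error R \<Gamma>0 \<Gamma>0 \<Gamma>1 n)"
    unfolding p_def by (intro add_left_mono sum_mono past_decoupling[OF R psiR B(1) B F])
  finally show ?thesis by (simp add: p_def)
qed

text \<open>
  The process \<open>hazard_value\<close> starts at the geometric probability of \<open>G\<close> and agrees at time \<open>M\<close> with the
  indicator of the event that the stopped count lies in \<open>G\<close>, except when no hazard occurs before \<open>M\<close>.
  Its increments are centred hits times functions of the past.
\<close>

lemma geometric_approximation:
  assumes R: "1 \<le> R" and psiR: "psi (enat R) < 2 powr (1 / (real l + 1)) - 1"
    and B: "\<Gamma>0 \<in> sets borel" "\<Gamma>1 \<in> sets borel" and disj: "\<Gamma>0 \<inter> \<Gamma>1 = {}"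
    and pos: "0 < law \<Gamma>0" and G: "G \<in> sets borel"
  shows "\<bar>prob {\<omega> \<in> space P. stopped_count \<xi> l q \<Gamma>0 \<Gamma>1 \<omega> \<in> G}
      - measure (Geo (law \<Gamma>0 ^ l / (law \<Gamma>0 ^ l + law \<Gamma>1 ^ l))) G\<bar>
     \<le> prob {\<omega> \<in> space P. hits \<Gamma>0 \<omega> \<inter> {..<M} = {}}
       + (\<Sum>n<M. past_error R \<Gamma>0 \<Gamma>0 \<Gamma>1 n + past_error R \<Gamma>1 \<Gamma>0 \<Gamma>1 n)"
proof -
  define p0 where "p0 = law \<Gamma>0 ^ l"
  define p1 where "p1 = law \<Gamma>1 ^ l"
  have p: "0 < p0" "0 \<le> p1" unfolding p0_def p1_def using pos law_nonneg by auto
  define \<rho> where "\<rho> = p0 / (p0 + p1)"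
  have \<rho>: "0 < \<rho>" "\<rho> \<le> 1" using p by (auto simp: \<rho>_def)
  define v where "v s = measure_pmf.prob (geometric_pmf \<rho>) {k. ereal (real (s + k)) \<in> G}" for s
  define \<phi> :: "nat \<Rightarrow> real" where "\<phi> s = of_bool (ereal (real s) \<in> G)" for s
  have v01: "0 \<le> v s" "v s \<le> 1" for s by (auto simp: v_def)
  \<comment> \<open>This equation allows the hit indicators to be centred in the increments below.\<close>
  have stein: "p0 * (\<phi> s - v s) + p1 * (v (Suc s) - v s) = 0" for s
  proof -
    have "v s = \<rho> * \<phi> s + (1 - \<rho>) * v (Suc s)"
      unfolding v_def \<phi>_def by (rule geometric_tail_recurrence[OF \<rho>])
    moreover have "1 - \<rho> = p1 / (p0 + p1)" using p by (simp add: \<rho>_def field_simps)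
    ultimately have "v s = (p0 * \<phi> s + p1 * v (Suc s)) / (p0 + p1)"
      by (simp add: \<rho>_def add_divide_distrib)
    then show ?thesis using p by (simp add: field_simps)
  qed
  define F0 where "F0 a b = of_bool (a = {}) * (\<phi> (card b) - v (card b))" for a b :: "nat set"
  define F1 where "F1 a b = of_bool (a = {}) * (v (Suc (card b)) - v (card b))" for a b :: "nat set"
  have F: "\<bar>F0 a b\<bar> \<le> 1" "\<bar>F1 a b\<bar> \<le> 1" for a b
    using v01[of "card b"] v01[of "Suc (card b)"] by (auto simp: F0_def F1_def \<phi>_def abs_if)
  let ?Z0 = "\<lambda>n \<omega>. (of_bool (n \<in> hits \<Gamma>0 \<omega>) - p0) * F0 (hits \<Gamma>0 \<omega> \<inter> {..<n}) (hits \<Gamma>1 \<omega> \<inter> {..<n})"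
  let ?Z1 = "\<lambda>n \<omega>. (of_bool (n \<in> hits \<Gamma>1 \<omega>) - p1) * F1 (hits \<Gamma>0 \<omega> \<inter> {..<n}) (hits \<Gamma>1 \<omega> \<inter> {..<n})"
  let ?V = "\<lambda>n \<omega>. hazard_value v \<phi> n (hits \<Gamma>0 \<omega>) (hits \<Gamma>1 \<omega>)"
  have step: "?V (Suc n) \<omega> - ?V n \<omega> = ?Z0 n \<omega> + ?Z1 n \<omega>" for n \<omega>
  proof -
    have "x * c + y * d = (x - p0) * c + (y - p1) * d" if "p0 * c + p1 * d = 0" for x y c d :: real
      using that by (simp add: algebra_simps)
    from this[OF stein] show ?thesis
      unfolding hazard_value_Suc[OF hits_disjoint[OF disj]] F0_def F1_def
      by (cases "hits \<Gamma>0 \<omega> \<inter> {..<n} = {}") simp_all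
  qed
  have VM: "?V M \<omega> = v 0 + (\<Sum>n<M. ?Z0 n \<omega> + ?Z1 n \<omega>)" for \<omega>
  proof -
    have "(\<Sum>n<M. ?Z0 n \<omega> + ?Z1 n \<omega>) = ?V M \<omega> - ?V 0 \<omega>"
      unfolding step[symmetric] by (rule sum_lessThan_telescope)
    then show ?thesis by (simp add: hazard_value_def)
  qed
  have int: "integrable P (?Z0 n)" "integrable P (?Z1 n)" for n
    unfolding p0_def p1_def
    by (rule integrable_pattern[OF B(1) B F(1)] integrable_pattern[OF B(2) B F(2)])+
  have intV: "integrable P (?V M)"
    unfolding VM using int by (intro Bochner_Integration.integrable_add Bochner_Integration.integrable_sum) auto
  have EV: "\<bar>expectation (?V M) - v 0\<bar> \<le> (\<Sum>n<M. past_error R \<Gamma>0 \<Gamma>0 \<Gamma>1 n + past_error R \<Gamma>1 \<Gamma>0 \<Gamma>1 n)"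
  proof -
    have "expectation (?V M) - v 0 = (\<Sum>n<M. expectation (?Z0 n) + expectation (?Z1 n))"
      unfolding VM using int by (simp add: prob_space)
    then have "\<bar>expectation (?V M) - v 0\<bar> \<le> (\<Sum>n<M. \<bar>expectation (?Z0 n)\<bar> + \<bar>expectation (?Z1 n)\<bar>)"
      by (simp only:) (rule order_trans[OF sum_abs], intro sum_mono abs_triangle_ineq)
    also have "\<dots> \<le> (\<Sum>n<M. past_error R \<Gamma>0 \<Gamma>0 \<Gamma>1 n + past_error R \<Gamma>1 \<Gamma>0 \<Gamma>1 n)"
      unfolding p0_def p1_def
      by (intro sum_mono add_mono past_decoupling[OF R psiR B(1) B F(1)] past_decoupling[OF R psiR B(2) B F(2)])
    finally show ?thesis .
  qed
  let ?E = "{\<omega> \<in> space P. stopped_count \<xi> l q \<Gamma>0 \<Gamma>1 \<omega> \<in> G}"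
  let ?S = "{\<omega> \<in> space P. hits \<Gamma>0 \<omega> \<inter> {..<M} = {}}"
  have E: "?E \<in> events"
  proof -
    have "?E = stopped_count \<xi> l q \<Gamma>0 \<Gamma>1 -` G \<inter> space P" by auto
    then show ?thesis using measurable_sets[OF measurable_stopped_count[OF B] G] by simp
  qed
  have S: "?S \<in> events"
  proof -
    have "?S = {\<omega> \<in> space P. \<forall>m\<in>{..<M}. m \<notin> hits \<Gamma>0 \<omega>}" by auto
    also have "\<dots> \<in> events" using B(1) by measurable
    finally show ?thesis .
  qed
  have close: "\<bar>indicator ?E \<omega> - ?V M \<omega>\<bar> \<le> indicator ?S \<omega>" if "\<omega> \<in> space P" for \<omega>
  proof (cases "\<omega> \<in> ?S")
    case True
    then have "?V M \<omega> = v (card (hits \<Gamma>1 \<omega> \<inter> {..<M}))" by (simp add: hazard_value_def)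
    then show ?thesis using True v01[of "card (hits \<Gamma>1 \<omega> \<inter> {..<M})"]
      by (auto simp: indicator_def abs_if)
  next
    case False
    then have ne: "hits \<Gamma>0 \<omega> \<inter> {..<M} \<noteq> {}" using that by simp
    then have "hits \<Gamma>0 \<omega> \<noteq> {}" by auto
    from stopped_count_eq_card[OF this] have "indicator ?E \<omega> = ?V M \<omega>"
      using ne that by (simp add: hazard_value_def \<phi>_def indicator_def)
    then show ?thesis by simp
  qed
  have "prob ?E - expectation (?V M) = expectation (\<lambda>\<omega>. indicator ?E \<omega> - ?V M \<omega>)"
    using intV E by (simp add: emeasure_eq_measure)
  then have "\<bar>prob ?E - expectation (?V M)\<bar> \<le> expectation (\<lambda>\<omega>. \<bar>indicator ?E \<omega> - ?V M \<omega>\<bar>)"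
    by (simp only: integral_abs_bound)
  also have "\<dots> \<le> expectation (indicator ?S)"
    by (rule integral_mono[OF _ _ close])
      (use intV E S in \<open>auto simp: emeasure_eq_measure intro!: integrable_abs Bochner_Integration.integrable_diff\<close>)
  also have "\<dots> = prob ?S" using S by simp
  finally have 1: "\<bar>prob ?E - expectation (?V M)\<bar> \<le> prob ?S" .
  have "measure (Geo \<rho>) G = v 0"
    unfolding Geo_def v_def using G by (subst measure_distr) (auto simp: vimage_def)
  then show ?thesis using 1 EV unfolding \<rho>_def p0_def p1_def by linarith
qed

section \<open>The total variation bound\<close>

definition total_const :: real where
  "total_const = 1 + 2 * (decoupling_const + 8 * (real l)\<^sup>2 * (1 + psi 1) ^ (l + 1))"

lemma past_error_nonneg: "0 \<le> past_error R A B B' n"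
  unfolding past_error_def
  by (intro add_nonneg_nonneg mult_nonneg_nonneg zero_le_power decoupling_const_nonneg psi_nonneg law_nonneg) auto

text \<open>
  Summing over both sets produces the common factor \<open>law \<Gamma>0 ^ l + law \<Gamma>1 ^ l\<close>.
\<close>

lemma sum_past_error:
  "(\<Sum>n<M. past_error R \<Gamma>0 \<Gamma>0 \<Gamma>1 n + past_error R \<Gamma>1 \<Gamma>0 \<Gamma>1 n)
    = (law \<Gamma>0 ^ l + law \<Gamma>1 ^ l) *
      (decoupling_const * (real M * psi (enat R) + (\<Sum>n<M. psi (min_gap l q n)))
       + 8 * (real l)\<^sup>2 * (1 + psi 1) ^ (l + 1) * ((law \<Gamma>0 + law \<Gamma>1) * real M * real R))"
  by (induction M) (auto simp: past_error_def algebra_simps power2_eq_square)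

lemma stopped_count_tv_bound:
  assumes R: "1 \<le> R" and psiR: "psi (enat R) < 2 powr (1 / (real l + 1)) - 1"
    and B: "\<Gamma>0 \<in> sets borel" "\<Gamma>1 \<in> sets borel" and disj: "\<Gamma>0 \<inter> \<Gamma>1 = {}"
    and pos: "0 < law \<Gamma>0"
  shows "tv_dist (distr P borel (stopped_count \<xi> l q \<Gamma>0 \<Gamma>1)) (Geo (law \<Gamma>0 ^ l / (law \<Gamma>0 ^ l + law \<Gamma>1 ^ l)))
     \<le> total_const * ((1 - law \<Gamma>0 ^ l) ^ M + (law \<Gamma>0 ^ l + law \<Gamma>1 ^ l) *
         ((law \<Gamma>0 + law \<Gamma>1) * real M * real R + real M * psi (enat R) + (\<Sum>n=0..M. psi (min_gap l q n))))"
  unfolding tv_dist_def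
proof (rule cSUP_least)
  fix G assume "G \<in> sets (distr P borel (stopped_count \<xi> l q \<Gamma>0 \<Gamma>1))"
  then have G: "G \<in> sets borel" by simp
  let ?e0 = "past_error R \<Gamma>0 \<Gamma>0 \<Gamma>1" and ?e1 = "past_error R \<Gamma>1 \<Gamma>0 \<Gamma>1"
  define K where "K = 8 * (real l)\<^sup>2 * (1 + psi 1) ^ (l + 1)"
  define s where "s = law \<Gamma>0 ^ l + law \<Gamma>1 ^ l"
  define a where "a = (law \<Gamma>0 + law \<Gamma>1) * real M * real R"
  define b where "b = real M * psi (enat R) + (\<Sum>n<M. psi (min_gap l q n))"
  define b' where "b' = real M * psi (enat R) + (\<Sum>n=0..M. psi (min_gap l q n))"
  define r where "r = (1 - law \<Gamma>0 ^ l) ^ M"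
  have K: "0 \<le> K" unfolding K_def using psi_nonneg[of 1] by simp
  have s: "0 \<le> s" unfolding s_def using law_nonneg by simp
  have a: "0 \<le> a" unfolding a_def using law_nonneg by simp
  have bb: "b \<le> b'"
    unfolding b_def b'_def by (auto intro!: sum_mono2 psi_nonneg)
  have b: "0 \<le> b" unfolding b_def by (auto intro!: sum_nonneg add_nonneg_nonneg mult_nonneg_nonneg psi_nonneg)
  have r: "0 \<le> r"
    unfolding r_def using law_nonneg[of \<Gamma>0] law_le_1[of \<Gamma>0] by (simp add: power_le_one)
  have "measure (distr P borel (stopped_count \<xi> l q \<Gamma>0 \<Gamma>1)) G
      = prob {\<omega> \<in> space P. stopped_count \<xi> l q \<Gamma>0 \<Gamma>1 \<omega> \<in> G}"
    by (subst measure_distr[OF measurable_stopped_count[OF B] G]) (auto intro: arg_cong[where f = prob])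
  then have "\<bar>measure (distr P borel (stopped_count \<xi> l q \<Gamma>0 \<Gamma>1)) G - measure (Geo (law \<Gamma>0 ^ l / (law \<Gamma>0 ^ l + law \<Gamma>1 ^ l))) G\<bar>
      \<le> prob {\<omega> \<in> space P. hits \<Gamma>0 \<omega> \<inter> {..<M} = {}} + (\<Sum>n<M. ?e0 n + ?e1 n)"
    using geometric_approximation[OF R psiR B disj pos G] by simp
  \<comment> \<open>The accumulated error enters twice: once through \<open>V\<close>, once through the survival probability.\<close>
  also have "prob {\<omega> \<in> space P. hits \<Gamma>0 \<omega> \<inter> {..<M} = {}} \<le> r + (\<Sum>n<M. ?e0 n)"
    unfolding r_def by (rule survival_bound[OF R psiR B])
  also have "(\<Sum>n<M. ?e0 n) \<le> (\<Sum>n<M. ?e0 n + ?e1 n)"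
    by (intro sum_mono) (simp add: past_error_nonneg)
  also have "r + (\<Sum>n<M. ?e0 n + ?e1 n) + (\<Sum>n<M. ?e0 n + ?e1 n) = r + 2 * (s * (decoupling_const * b + K * a))"
    unfolding sum_past_error K_def s_def a_def b_def by simp
  also have "\<dots> \<le> total_const * r + total_const * (s * (a + b'))"
  proof (rule add_mono)
    have t: "total_const = 1 + 2 * (decoupling_const + K)" by (simp add: total_const_def K_def)
    show "r \<le> total_const * r"
      unfolding t using K decoupling_const_nonneg r by (simp add: distrib_right)
    have "2 * (decoupling_const * b + K * a) \<le> total_const * b + total_const * a"
      unfolding t using K decoupling_const_nonneg a b
      by (simp add: algebra_simps)
    also have "\<dots> \<le> total_const * (a + b')"
      unfolding t using K decoupling_const_nonneg bb
      by (simp add: distrib_left[symmetric] mult_left_mono del: distrib_left_numeral)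
    finally have "s * (2 * (decoupling_const * b + K * a)) \<le> s * (total_const * (a + b'))"
      using s by (rule mult_left_mono)
    then show "2 * (s * (decoupling_const * b + K * a)) \<le> total_const * (s * (a + b'))"
      by (simp only: mult.left_commute)
  qed
  finally show "\<bar>measure (distr P borel (stopped_count \<xi> l q \<Gamma>0 \<Gamma>1)) G
        - measure (Geo (law \<Gamma>0 ^ l / (law \<Gamma>0 ^ l + law \<Gamma>1 ^ l))) G\<bar>
     \<le> total_const * ((1 - law \<Gamma>0 ^ l) ^ M + (law \<Gamma>0 ^ l + law \<Gamma>1 ^ l) *
         ((law \<Gamma>0 + law \<Gamma>1) * real M * real R + real M * psi (enat R) + (\<Sum>n=0..M. psi (min_gap l q n))))"
    unfolding r_def s_def a_def b'_def by (simp add: distrib_left add.assoc)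
qed auto

lemma total_const_pos: "0 < total_const"
  unfolding total_const_def using decoupling_const_nonneg psi_nonneg[of 1] by (intro add_pos_nonneg) auto

end

theorem theorem2p1:
  fixes P :: "'w measure" and \<xi> :: "nat \<Rightarrow> 'w \<Rightarrow> real"
    and l :: nat and q :: "nat \<Rightarrow> nat \<Rightarrow> nat" and Q :: "real set \<Rightarrow> real"
  assumes "prob_space P" and "complete_measure P"
    and "stationary_process P \<xi>" and "psi_mixing P \<xi>"
    and Q_def: "Q = measure (distr P borel (\<xi> 0))"
    and "l \<ge> 1"
    and "\<forall>i\<in>{1..l}. strict_mono (q i)"
    and "\<forall>n. \<forall>i\<in>{1..<l}. q i n < q (i + 1) n"
    and "min_gap l q \<longlonglongrightarrow> \<infinity>"
  shows "\<exists>C>0. \<forall>\<Gamma>0\<in>sets borel. \<forall>\<Gamma>1\<in>sets borel. \<forall>M\<ge>1. \<forall>R\<ge>1.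
           \<Gamma>0 \<inter> \<Gamma>1 = {} \<longrightarrow> Q \<Gamma>0 > 0 \<longrightarrow> Q \<Gamma>1 > 0 \<longrightarrow>
           psi_coeff P \<xi> (enat R) < ereal (2 powr (1 / (real l + 1)) - 1) \<longrightarrow>
           tv_dist (distr P borel (stopped_count \<xi> l q \<Gamma>0 \<Gamma>1))
                   (Geo (Q \<Gamma>0 ^ l / (Q \<Gamma>0 ^ l + Q \<Gamma>1 ^ l)))
           \<le> C * ((1 - Q \<Gamma>0 ^ l) ^ M
                  + (Q \<Gamma>0 ^ l + Q \<Gamma>1 ^ l)
                    * ((Q \<Gamma>0 + Q \<Gamma>1) * real M * real R
                       + real M * real_of_ereal (psi_coeff P \<xi> (enat R))
                       + (\<Sum>n=0..M. real_of_ereal (psi_coeff P \<xi> (min_gap l q n)))))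
             + 2 * Q \<Gamma>1 ^ l"
proof -
  interpret hitting_times P \<xi> l q
    using assms(1,3,4,6,7,8) by (simp add: hitting_times_def psi_mixing_process_def
        psi_mixing_process_axioms_def hitting_times_axioms_def)
  have Q_eq: "Q = law" by (simp add: Q_def law_def fun_eq_iff)
  show ?thesis
  proof (intro exI[of _ total_const] conjI ballI allI impI total_const_pos)
    fix \<Gamma>0 \<Gamma>1 :: "real set" and M R :: nat
    assume h: "\<Gamma>0 \<in> sets borel" "\<Gamma>1 \<in> sets borel" "1 \<le> R" "\<Gamma>0 \<inter> \<Gamma>1 = {}" "0 < Q \<Gamma>0"
      "psi_coeff P \<xi> (enat R) < ereal (2 powr (1 / (real l + 1)) - 1)"
    have psiR: "psi (enat R) < 2 powr (1 / (real l + 1)) - 1"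
      using h(6) psi_coeff_finite[OF assms(1,4) h(3)] unfolding psi_def
      by (cases "psi_coeff P \<xi> (enat R)") auto
    have "0 \<le> 2 * Q \<Gamma>1 ^ l" unfolding Q_eq using law_nonneg by simp
    then show "tv_dist (distr P borel (stopped_count \<xi> l q \<Gamma>0 \<Gamma>1))
                   (Geo (Q \<Gamma>0 ^ l / (Q \<Gamma>0 ^ l + Q \<Gamma>1 ^ l)))
           \<le> total_const * ((1 - Q \<Gamma>0 ^ l) ^ M
                  + (Q \<Gamma>0 ^ l + Q \<Gamma>1 ^ l)
                    * ((Q \<Gamma>0 + Q \<Gamma>1) * real M * real R
                       + real M * real_of_ereal (psi_coeff P \<xi> (enat R))
                       + (\<Sum>n=0..M. real_of_ereal (psi_coeff P \<xi> (min_gap l q n)))))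
             + 2 * Q \<Gamma>1 ^ l"
      using stopped_count_tv_bound[OF h(3) psiR h(1,2,4) h(5)[unfolded Q_eq], of M]
      unfolding Q_eq psi_def by linarith
  qed
qed

end
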